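(* Let $q$ be an odd prime power and $\Gamma=Sp_4(\mathbb F_q[T])=\{A\in M_{4\times4}(\mathbb F_q[T]):A^tJA=J\}$ (with $J$ the $4\times4$ matrix with $J_{14}=J_{23}=1$, $J_{32}=J_{41}=-1$, other entries $0$); it is a finitely generated group. There exists a length function $\ell:\Gamma\to\mathbb R_{\ge0}$, bi-Lipschitz equivalent to the word length on $\Gamma$, such that: the constant function $1$ on $\Gamma$ is not the pointwise limit of any family $(f_\alpha)_{\alpha\in I}$ of finitely supported $\ell$-radial functions on $\Gamma$ with $\sup_{\alpha}\|m_{f_\alpha}\|_{MC^*_r(\Gamma)}<\infty$; and for every finite $p>4$, it is not the pointwise limit of any family $(f_\alpha)_{\alpha\in I}$ of finitely supported $\ell$-radial functions on $\Gamma$ with $\sup_\alpha\|m_{f_\alpha}\|_{ML^p(L\Gamma)}<\infty$.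
   Context: A length function is $\ell:\Gamma\to\mathbb R_{\ge0}$ with $\ell(\gamma\gamma')\le\ell(\gamma)+\ell(\gamma')$; a function $f$ is $\ell$-radial if $f(\gamma)=f(\gamma')$ whenever $\ell(\gamma)=\ell(\gamma')$. $L(\Gamma)$ is the group von Neumann algebra with trace $\tau(x)=\langle\delta_1,x\delta_1\rangle$, $L^p(L\Gamma)$ the completion of $L(\Gamma)$ under $\tau(|x|^p)^{1/p}$, and for $\varphi\in\mathbb C\Gamma$ (finitely supported) its $C^*_r$-norm is the operator norm of $\lambda(\varphi)$ on $\ell^2\Gamma$. Fourier multiplier norms (not necessarily completely bounded): $\|m_f\|_{ML^p(L\Gamma)}=\sup\{\|f\varphi\|_{L^p(L\Gamma)}:\varphi\in\mathbb C\Gamma,\|\varphi\|_{L^p(L\Gamma)}\le1\}$ (pointwise product), and $\|m_f\|_{MC^*_r(\Gamma)}$ is defined the same way with the $C^*_r(\Gamma)$-norm. *)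

theory Defs
  imports "HOL-Analysis.Analysis" "HOL-Algebra.Group"
    "HOL-Computational_Algebra.Polynomial" "HOL-Library.Numeral_Type"
begin

section \<open>Generic notions for a (discrete) group G given as a HOL-Algebra structure\<close>

text \<open>Functions on the group are complex-valued functions on the ambient type; only
  their values on carrier G matter.\<close>

definition length_function :: "('g, 'b) monoid_scheme \<Rightarrow> ('g \<Rightarrow> real) \<Rightarrow> bool" where
  "length_function G l \<longleftrightarrow>
     (\<forall>g\<in>carrier G. 0 \<le> l g) \<and>
     (\<forall>g\<in>carrier G. \<forall>h\<in>carrier G. l (g \<otimes>\<^bsub>G\<^esub> h) \<le> l g + l h)"

definition radial :: "('g, 'b) monoid_scheme \<Rightarrow> ('g \<Rightarrow> real) \<Rightarrow> ('g \<Rightarrow> complex) \<Rightarrow> bool" where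
  "radial G l f \<longleftrightarrow> (\<forall>g\<in>carrier G. \<forall>h\<in>carrier G. l g = l h \<longrightarrow> f g = f h)"

definition fin_supp :: "('g, 'b) monoid_scheme \<Rightarrow> ('g \<Rightarrow> complex) \<Rightarrow> bool" where
  "fin_supp G f \<longleftrightarrow> finite {g \<in> carrier G. f g \<noteq> 0}"

text \<open>Words over a generating set S (letters from S and their inverses).\<close>
definition is_word :: "('g, 'b) monoid_scheme \<Rightarrow> 'g set \<Rightarrow> 'g list \<Rightarrow> 'g \<Rightarrow> bool" where
  "is_word G S xs g \<longleftrightarrow>
     set xs \<subseteq> S \<union> (\<lambda>s. inv\<^bsub>G\<^esub> s) ` S \<and> foldr (\<lambda>x y. x \<otimes>\<^bsub>G\<^esub> y) xs \<one>\<^bsub>G\<^esub> = g"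

definition finite_generating_set :: "('g, 'b) monoid_scheme \<Rightarrow> 'g set \<Rightarrow> bool" where
  "finite_generating_set G S \<longleftrightarrow> finite S \<and> S \<subseteq> carrier G \<and>
     (\<forall>g\<in>carrier G. \<exists>xs. is_word G S xs g)"

definition word_length :: "('g, 'b) monoid_scheme \<Rightarrow> 'g set \<Rightarrow> 'g \<Rightarrow> nat" where
  "word_length G S g = (LEAST n. \<exists>xs. length xs = n \<and> is_word G S xs g)"

text \<open>Bi-Lipschitz equivalence of l with the word length of some (equivalently: any)
  finite generating set.\<close>
definition bilipschitz_to_word_length :: "('g, 'b) monoid_scheme \<Rightarrow> ('g \<Rightarrow> real) \<Rightarrow> bool" where
  "bilipschitz_to_word_length G l \<longleftrightarrow>
     (\<exists>S C. finite_generating_set G S \<and> C > 0 \<and>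
        (\<forall>g\<in>carrier G. l g \<le> C * real (word_length G S g) \<and>
                         real (word_length G S g) \<le> C * l g))"

subsection \<open>Group algebra, left regular representation, reduced C*-norm\<close>

definition supp :: "('g, 'b) monoid_scheme \<Rightarrow> ('g \<Rightarrow> complex) \<Rightarrow> 'g set" where
  "supp G f = {g \<in> carrier G. f g \<noteq> 0}"

text \<open>Convolution (= action of lambda(phi) on xi), for phi finitely supported.\<close>
definition conv :: "('g, 'b) monoid_scheme \<Rightarrow> ('g \<Rightarrow> complex) \<Rightarrow> ('g \<Rightarrow> complex) \<Rightarrow> 'g \<Rightarrow> complex" where
  "conv G \<phi> \<xi> g = (\<Sum>h\<in>supp G \<phi>. \<phi> h * \<xi> (inv\<^bsub>G\<^esub> h \<otimes>\<^bsub>G\<^esub> g))"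

definition is_l2 :: "('g, 'b) monoid_scheme \<Rightarrow> ('g \<Rightarrow> complex) \<Rightarrow> bool" where
  "is_l2 G \<xi> \<longleftrightarrow> (\<lambda>g. (cmod (\<xi> g))\<^sup>2) summable_on carrier G"

definition l2_norm :: "('g, 'b) monoid_scheme \<Rightarrow> ('g \<Rightarrow> complex) \<Rightarrow> real" where
  "l2_norm G \<xi> = sqrt (\<Sum>\<^sub>\<infinity>g\<in>carrier G. (cmod (\<xi> g))\<^sup>2)"

text \<open>Norm of phi in the reduced group C*-algebra: operator norm of lambda(phi) on l2(G).\<close>
definition cred_norm :: "('g, 'b) monoid_scheme \<Rightarrow> ('g \<Rightarrow> complex) \<Rightarrow> real" where
  "cred_norm G \<phi> = Sup {l2_norm G (conv G \<phi> \<xi>) | \<xi>. is_l2 G \<xi> \<and> l2_norm G \<xi> \<le> 1}"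

subsection \<open>Noncommutative L^p norms on the group von Neumann algebra\<close>

definition delta_one :: "('g, 'b) monoid_scheme \<Rightarrow> 'g \<Rightarrow> complex" where
  "delta_one G g = (if g = \<one>\<^bsub>G\<^esub> then 1 else 0)"

definition adj :: "('g, 'b) monoid_scheme \<Rightarrow> ('g \<Rightarrow> complex) \<Rightarrow> 'g \<Rightarrow> complex" where
  "adj G \<phi> g = cnj (\<phi> (inv\<^bsub>G\<^esub> g))"

text \<open>tau(lambda(phi)) = phi(1).\<close>
definition tau :: "('g, 'b) monoid_scheme \<Rightarrow> ('g \<Rightarrow> complex) \<Rightarrow> complex" where
  "tau G \<phi> = \<phi> \<one>\<^bsub>G\<^esub>"

primrec conv_pow :: "('g, 'b) monoid_scheme \<Rightarrow> ('g \<Rightarrow> complex) \<Rightarrow> nat \<Rightarrow> 'g \<Rightarrow> complex" where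
  "conv_pow G \<phi> 0 = delta_one G"
| "conv_pow G \<phi> (Suc n) = conv G \<phi> (conv_pow G \<phi> n)"

text \<open>Spectral distribution of x*x w.r.t. tau, where x = lambda(phi): the compactly
  supported finite Borel measure on the reals whose moments are tau((x*x)^n).\<close>
definition spectral_distribution ::
  "('g, 'b) monoid_scheme \<Rightarrow> ('g \<Rightarrow> complex) \<Rightarrow> real measure \<Rightarrow> bool" where
  "spectral_distribution G \<phi> \<mu> \<longleftrightarrow>
     sets \<mu> = sets borel \<and> finite_measure \<mu> \<and>
     (\<exists>C. emeasure \<mu> (UNIV - {0..C}) = 0) \<and>
     (\<forall>n. integrable \<mu> (\<lambda>t. t ^ n) \<and>
          complex_of_real (\<integral>t. t ^ n \<partial>\<mu>) = tau G (conv_pow G (conv G (adj G \<phi>) \<phi>) n))"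

text \<open>||lambda(phi)||_p = tau(|x|^p)^(1/p) = (integral of t^(p/2) against the spectral
  distribution of x*x)^(1/p).\<close>
definition Lp_norm :: "('g, 'b) monoid_scheme \<Rightarrow> real \<Rightarrow> ('g \<Rightarrow> complex) \<Rightarrow> real" where
  "Lp_norm G p \<phi> =
     (\<integral>t. t powr (p / 2) \<partial>(SOME \<mu>. spectral_distribution G \<phi> \<mu>)) powr (1 / p)"

subsection \<open>Fourier multiplier norms (bounds)\<close>

text \<open>||m_f||_{MC*_r(G)} <= C\<close>
definition MCr_bounded_by :: "('g, 'b) monoid_scheme \<Rightarrow> real \<Rightarrow> ('g \<Rightarrow> complex) \<Rightarrow> bool" where
  "MCr_bounded_by G C f \<longleftrightarrow>
     (\<forall>\<phi>. fin_supp G \<phi> \<and> cred_norm G \<phi> \<le> 1 \<longrightarrow> cred_norm G (\<lambda>g. f g * \<phi> g) \<le> C)"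

text \<open>||m_f||_{ML^p(LG)} <= C\<close>
definition MLp_bounded_by ::
  "('g, 'b) monoid_scheme \<Rightarrow> real \<Rightarrow> real \<Rightarrow> ('g \<Rightarrow> complex) \<Rightarrow> bool" where
  "MLp_bounded_by G p C f \<longleftrightarrow>
     (\<forall>\<phi>. fin_supp G \<phi> \<and> Lp_norm G p \<phi> \<le> 1 \<longrightarrow> Lp_norm G p (\<lambda>g. f g * \<phi> g) \<le> C)"

subsection \<open>Pointwise approximation of 1 by bounded nets of radial functions\<close>

text \<open>A net (f_alpha)_{alpha in I} is a family over a directed index set; we encode the
  directedness by a proper filter F on the index type with I eventually in F.
  The index type is the space of functions on G, which suffices (any net can be replaced
  by its image filter on the function space).  "bounded" is the multiplier-norm bound.\<close>
definition one_radial_approx ::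
  "('g, 'b) monoid_scheme \<Rightarrow> ('g \<Rightarrow> real) \<Rightarrow> (real \<Rightarrow> ('g \<Rightarrow> complex) \<Rightarrow> bool) \<Rightarrow> bool" where
  "one_radial_approx G l bdd \<longleftrightarrow>
     (\<exists>(I :: ('g \<Rightarrow> complex) set) (F :: ('g \<Rightarrow> complex) filter) fam C.
        F \<noteq> bot \<and> eventually (\<lambda>\<alpha>. \<alpha> \<in> I) F \<and>
        (\<forall>\<alpha>\<in>I. fin_supp G (fam \<alpha>) \<and> radial G l (fam \<alpha>) \<and> bdd C (fam \<alpha>)) \<and>
        (\<forall>g\<in>carrier G. ((\<lambda>\<alpha>. fam \<alpha> g) \<longlongrightarrow> 1) F))"

section \<open>The group Sp_4(F_q[T])\<close>

definition J4 :: "'k::comm_ring_1 poly ^ 4 ^ 4" where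
  "J4 = (\<chi> i j. if (i, j) = (1, 4) \<or> (i, j) = (2, 3) then 1
               else if (i, j) = (3, 2) \<or> (i, j) = (4, 1) then -1 else 0)"

definition Sp4 :: "('k::field poly ^ 4 ^ 4) monoid" where
  "Sp4 = \<lparr>carrier = {A. transpose A ** J4 ** A = J4}, mult = (**), one = mat 1\<rparr>"

end

theory Submission
  imports Defs "HOL-Probability.Probability" "HOL-Computational_Algebra.Fraction_Field"
    "HOL-Number_Theory.Cong"
begin

text \<open>
  The length of \<open>g \<noteq> 1\<close> is one plus the maximal degree of the entries and of the 2x2 minors of \<open>g\<close>.

  Comparison with the word length: conjugation by powers of a hyperbolic element of the \<open>SL\<^sub>2\<close> attached
  to a long root writes the elements of the Heisenberg group it normalises as words whose length is
  linear in the degree, and the division algorithm reduces an arbitrary matrix to elementary ones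
  at a cost that is linear in the degree, because the degrees of the quotients add up.

  Multipliers: in the abelian unipotent group of matrices with upper right block \<open>(b, a; c, b)\<close> the
  length is governed by the degree of the quadratic form \<open>b\<^sup>2 - a c\<close>. With \<open>c = T\<^sup>s\<close>, the difference of the
  normalised indicator functions of two consecutive levels has Fourier transform at most
  \<open>2 q\<^bsup>-(s-j)/2\<^esup>\<close> by a Gauss sum estimate. Testing a bounded multiplier against this difference shows
  that the values of a radial multiplier on consecutive levels differ by an exponentially small
  amount; for the Lp norms one interpolates between sup norm and L2 norm, which gives decay exactly
  if \<open>p > 4\<close>. A finitely supported radial function is therefore uniformly small at large lengths.
\<close>

section \<open>The symplectic group\<close>

text \<open>Entry degrees alone would not separate the test matrices: with \<open>c = T^s\<close>
  and \<open>a\<close>, \<open>b\<close> of degree at most s their maximum is always s, while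
  \<open>b^2 - a c\<close> takes every degree s + k with k \<le> s. The minors supply this second
  direction; they at most double a degree, so the comparison with the word length survives.
  Neighbouring levels are compared because the transform of a single level set is large at and near
  the trivial character. In the difference the characters that do not see the two levels cancel, and
  for the others the Gauss sum has a small kernel. The threshold 4 comes from a balance. Put r = s -
  j. Keeping \<open>c\<close> on the line spanned by \<open>T^s\<close> makes the abelian group only
  q^(r+2) times as large as a level set. The trivial character has mass one over the group order,
  which costs q^(r/p) up to constants, whereas interpolation turns the Gauss sum gain q^(-r/2) into
  q^(-r(p-2)/(2p)). The product is q^(-r(p-4)/(2p)).\<close>

lemmas mat4 = vec_eq_iff forall_4 matrix_matrix_mult_def sum_4 transpose_def mat_def

lemma J4_sq: "(J4 :: 'k::comm_ring_1 poly^4^4) ** J4 = - mat 1"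
  by (simp add: mat4 J4_def)

lemma transpose_J4: "transpose (J4 :: 'k::comm_ring_1 poly^4^4) = - J4"
  by (simp add: mat4 J4_def)

lemma matrix_minus_left: "(- A) ** B = - (A ** B)"
  for A :: "'a::ring_1^'l^'m" and B :: "'a^'n^'l"
  by (simp add: vec_eq_iff matrix_matrix_mult_def sum_negf)

lemma matrix_minus_right: "A ** (- B) = - (A ** B)"
  for A :: "'a::ring_1^'l^'m" and B :: "'a^'n^'l"
  by (simp add: vec_eq_iff matrix_matrix_mult_def sum_negf)

text \<open>Over the fraction field a one-sided inverse of a square matrix is two-sided; applying
  \<open>Fract _ 1\<close> entrywise is an injective ring homomorphism, so the identity descends to
  the domain.\<close>

lemma matrix_left_right_inverse_idom:
  fixes A B :: "'a::idom^'n^'n"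
  assumes "A ** B = mat 1"
  shows "B ** A = mat 1"
proof -
  define F :: "'a^'n^'n \<Rightarrow> 'a fract^'n^'n" where "F = (\<lambda>M. \<chi> i j. Fract (M$i$j) 1)"
  have Fsum: "Fract (sum f S) 1 = (\<Sum>i\<in>S. Fract (f i) 1)" if "finite S" for f :: "'n \<Rightarrow> 'a" and S
    using that
  proof (induction S rule: finite_induct)
    case (insert i S)
    show ?case using insert.hyps by (simp flip: insert.IH)
  qed (simp add: Zero_fract_def)
  have Fmult: "F (M ** N) = F M ** F N" for M N
    by (simp add: F_def vec_eq_iff matrix_matrix_mult_def Fsum)
  have F1: "F (mat 1) = mat 1"
    by (simp add: F_def vec_eq_iff mat_def One_fract_def Zero_fract_def)
  have "F A ** F B = mat 1" using assms F1 Fmult by metis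
  then have "F B ** F A = mat 1" by (simp add: matrix_left_right_inverse)
  then have "F (B ** A) = F (mat 1)" by (simp add: Fmult F1)
  then show ?thesis by (simp add: F_def vec_eq_iff eq_fract)
qed

abbreviation SP :: "('k::field poly ^ 4 ^ 4) set" where "SP \<equiv> carrier Sp4"

lemma Sp4_iff: "A \<in> SP \<longleftrightarrow> transpose A ** J4 ** A = J4"
  by (simp add: Sp4_def)

lemma Sp4_simps [simp]: "A \<otimes>\<^bsub>Sp4\<^esub> B = A ** B" "\<one>\<^bsub>Sp4\<^esub> = mat 1"
  by (simp_all add: Sp4_def)

text \<open>Since \<open>J4\<close> squares to -1, the defining relation of the group says that this
  matrix is a left inverse. The formula only permutes entries up to sign, so inversion visibly keeps
  entry degrees.\<close>

definition spinv :: "'k::field poly ^ 4 ^ 4 \<Rightarrow> 'k poly ^ 4 ^ 4" where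
  "spinv A = - (J4 ** transpose A ** J4)"

lemma spinv_left: "A \<in> SP \<Longrightarrow> spinv A ** A = mat 1"
  by (simp add: spinv_def Sp4_iff matrix_minus_left matrix_mul_assoc[symmetric] J4_sq)

lemma spinv_right: "A \<in> SP \<Longrightarrow> A ** spinv A = mat 1"
  by (rule matrix_left_right_inverse_idom) (rule spinv_left)

text \<open>Cancelling \<open>J4\<close> in \<open>A ** spinv A = mat 1\<close> gives
  \<open>A ** J4 ** transpose A = J4\<close>; the passage from the left to the right inverse is the
  real content.\<close>

lemma Sp4_transpose: 
  assumes "A \<in> SP" shows "transpose A \<in> SP"
proof -
  have "A ** J4 ** transpose A ** J4 = - mat 1"
    using spinv_right[OF assms] 
    by (simp add: spinv_def matrix_minus_right matrix_mul_assoc) (metis minus_minus)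
  then have "A ** J4 ** transpose A ** (J4 ** J4) = - J4"
    by (simp add: matrix_mul_assoc matrix_minus_left)
  then have "A ** J4 ** transpose A = J4"
    by (simp add: J4_sq matrix_minus_right)
  then show ?thesis by (simp add: Sp4_iff)
qed

lemma Sp4_mult: "A \<in> SP \<Longrightarrow> B \<in> SP \<Longrightarrow> A ** B \<in> SP"
  unfolding Sp4_iff matrix_transpose_mul by (metis matrix_mul_assoc)

lemma Sp4_one [simp]: "mat 1 \<in> SP"
  by (simp add: Sp4_iff transpose_mat)

lemma Sp4_J4 [simp]: "J4 \<in> SP"
  by (simp add: Sp4_iff transpose_J4 J4_sq matrix_minus_left)

lemma Sp4_uminus: "A \<in> SP \<Longrightarrow> - A \<in> SP"
proof -
  assume "A \<in> SP"
  moreover have "transpose (- A) = - transpose A" by (simp add: transpose_def vec_eq_iff)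
  ultimately show ?thesis by (simp add: Sp4_iff matrix_minus_left matrix_minus_right)
qed

lemma Sp4_spinv: "A \<in> SP \<Longrightarrow> spinv A \<in> SP"
  unfolding spinv_def by (intro Sp4_uminus Sp4_mult Sp4_transpose Sp4_J4)

lemma group_Sp4: "group (Sp4 :: ('k::field poly ^ 4 ^ 4) monoid)"
proof (rule groupI)
  fix A :: "'k poly^4^4" assume A: "A \<in> SP"
  show "\<exists>B\<in>SP. B \<otimes>\<^bsub>Sp4\<^esub> A = \<one>\<^bsub>Sp4\<^esub>"
    using spinv_left[OF A] Sp4_spinv[OF A] by auto
qed (auto simp: Sp4_mult matrix_mul_assoc)

section \<open>Entry degrees and words in the generators of degree at most one\<close>

definition dle :: "'k::field poly^4^4 \<Rightarrow> nat \<Rightarrow> bool" where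
  "dle A n \<longleftrightarrow> (\<forall>i j. degree (A$i$j) \<le> n)"

lemma dle_mono: "dle A m \<Longrightarrow> m \<le> n \<Longrightarrow> dle A n"
  unfolding dle_def using order_trans by blast

lemma dle_mult: "dle A m \<Longrightarrow> dle B n \<Longrightarrow> dle (A ** B) (m + n)"
  unfolding dle_def matrix_matrix_mult_def
  by (auto intro!: degree_sum_le order_trans[OF degree_mult_le] add_mono)

lemma dle_transpose: "dle A n \<Longrightarrow> dle (transpose A) n"
  by (simp add: dle_def transpose_def)

lemma dle_one: "dle (mat 1) n"
  by (simp add: dle_def mat_def)

lemma dle_J4: "dle J4 0"
  by (simp add: dle_def J4_def)

lemma dle_spinv: "dle A n \<Longrightarrow> dle (spinv A) n"
  using dle_mult[OF dle_mult[OF dle_J4 dle_transpose] dle_J4, of A n]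
  by (simp add: dle_def spinv_def)

text \<open>Finite over a finite field, and closed under transposition and inversion because both
  keep entry degrees. Words can therefore be transposed and inverted without changing their
  length.\<close>

definition gens :: "('k::field poly^4^4) set" where
  "gens = {A \<in> SP. dle A 1}"

text \<open>An upper bound rather than the exact length, so that estimates are monotone in n and add
  up under products.\<close>

definition len :: "'k::field poly^4^4 \<Rightarrow> nat \<Rightarrow> bool" where
  "len A n \<longleftrightarrow> (\<exists>xs. length xs \<le> n \<and> set xs \<subseteq> gens \<and> foldr (**) xs (mat 1) = A)"

lemma len_mono: "len A m \<Longrightarrow> m \<le> n \<Longrightarrow> len A n"
  unfolding len_def using order_trans by blast

lemma len_one: "len (mat 1) n"
  unfolding len_def by (rule exI[of _ "[]"]) auto

lemma len_gen: "A \<in> gens \<Longrightarrow> len A 1"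
  unfolding len_def by (rule exI[of _ "[A]"]) auto

lemma foldr_mult_append:
  "foldr (**) (xs @ ys) (mat 1) = foldr (**) xs (mat 1) ** (foldr (**) ys (mat 1) :: 'k::field poly^4^4)"
  by (induction xs) (auto simp: matrix_mul_assoc)

lemma len_mult: "len A m \<Longrightarrow> len B n \<Longrightarrow> len (A ** B) (m + n)"
proof -
  assume "len A m" "len B n"
  then obtain xs ys where "length xs \<le> m" "set xs \<subseteq> gens" "foldr (**) xs (mat 1) = A"
    "length ys \<le> n" "set ys \<subseteq> gens" "foldr (**) ys (mat 1) = B"
    unfolding len_def by auto
  then show ?thesis unfolding len_def
    by (intro exI[of _ "xs @ ys"]) (auto simp: foldr_mult_append simp del: foldr_append)
qed

lemma len_induct [consumes 1, case_names one mult]: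
  assumes "len A n" "\<And>n. P (mat 1) n"
    "\<And>s B m. s \<in> gens \<Longrightarrow> len B m \<Longrightarrow> P B m \<Longrightarrow> P (s ** B) (Suc m)"
  shows "P A n"
proof -
  obtain xs where "length xs \<le> n" "set xs \<subseteq> gens" "foldr (**) xs (mat 1) = A"
    using assms(1) unfolding len_def by auto
  then show ?thesis
  proof (induction xs arbitrary: n A)
    case Nil then show ?case using assms(2) by auto
  next
    case (Cons s xs)
    then obtain m where m: "n = Suc m" by (cases n) auto
    have "len (foldr (**) xs (mat 1)) m" unfolding len_def
      using Cons.prems m by (intro exI[of _ xs]) auto
    with Cons m assms(3)[of s "foldr (**) xs (mat 1)" m] show ?case by auto
  qed
qed

lemma len_Sp4: "len A n \<Longrightarrow> A \<in> SP"
  by (induction rule: len_induct) (auto simp: gens_def Sp4_mult)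

lemma len_dle: "len A n \<Longrightarrow> dle A n"
proof (induction rule: len_induct)
  case (mult s B m)
  then show ?case using dle_mult[of s 1 B m] by (simp add: gens_def)
qed (simp add: dle_one)

lemma len_transpose: "len A n \<Longrightarrow> len (transpose A) n"
proof (induction rule: len_induct)
  case (mult s B m)
  have "transpose s \<in> gens" using mult(1) by (simp add: gens_def Sp4_transpose dle_transpose)
  from len_mult[OF mult(3) len_gen[OF this]] show ?case by (simp add: matrix_transpose_mul)
qed (simp add: len_one transpose_mat)

lemma spinv_mult: 
  "spinv (A ** B) = spinv B ** spinv A"
proof -
  have "spinv B ** spinv A = J4 ** transpose B ** (J4 ** J4) ** transpose A ** J4"
    by (simp add: spinv_def matrix_minus_left matrix_minus_right matrix_mul_assoc)
  also have "\<dots> = spinv (A ** B)"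
    by (simp add: spinv_def J4_sq matrix_minus_left matrix_minus_right matrix_mul_assoc matrix_transpose_mul)
  finally show ?thesis by simp
qed

lemma spinv_one: "spinv (mat 1) = mat 1"
  by (simp add: spinv_def J4_sq transpose_mat)

lemma len_spinv: "len A n \<Longrightarrow> len (spinv A) n"
proof (induction rule: len_induct)
  case (mult s B m)
  have "spinv s \<in> gens" using mult(1) by (simp add: gens_def Sp4_spinv dle_spinv)
  from len_mult[OF mult(3) len_gen[OF this]] show ?case by (simp add: spinv_mult)
qed (simp add: len_one spinv_one)

section \<open>The Heisenberg subgroup and short words for its elements\<close>

definition heis :: "'k::field poly \<Rightarrow> 'k poly \<Rightarrow> 'k poly \<Rightarrow> 'k poly^4^4" where
  "heis x y z = (\<chi> i j. if i = j then 1 else if (i,j) = (1,2) then x else if (i,j) = (1,3) then y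
     else if (i,j) = (1,4) then z else if (i,j) = (2,4) then y else if (i,j) = (3,4) then - x else 0)"

text \<open>For determinant 1 this is the \<open>SL_2\<close> of a long root. It normalises the
  group of the \<open>heis x y z\<close>, acts linearly on the pairs (x, y) and fixes the central
  coordinate z.\<close>

definition blk :: "'k::field poly \<Rightarrow> 'k poly \<Rightarrow> 'k poly \<Rightarrow> 'k poly \<Rightarrow> 'k poly^4^4" where
  "blk a b c d = (\<chi> i j. if (i,j) = (1,1) \<or> (i,j) = (4,4) then 1 else if (i,j) = (2,2) then a
     else if (i,j) = (2,3) then b else if (i,j) = (3,2) then c else if (i,j) = (3,3) then d else 0)"

lemma heis_Sp4: "heis x y z \<in> SP"
  by (simp add: Sp4_iff mat4 J4_def heis_def)

lemma blk_Sp4: "a * d - b * c = 1 \<Longrightarrow> blk a b c d \<in> SP"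
  by (simp add: Sp4_iff mat4 J4_def blk_def algebra_simps)

lemma heis_mult: "heis x y z ** heis x' y' z' = heis (x + x') (y + y') (z + z' + x * y' - y * x')"
  by (simp add: mat4 heis_def algebra_simps)

lemma heis_zero: "heis 0 0 0 = mat 1"
  by (simp add: mat4 heis_def)

lemma spinv_eqI: "A \<in> SP \<Longrightarrow> A ** B = mat 1 \<Longrightarrow> spinv A = B"
  by (metis matrix_mul_assoc matrix_mul_lid matrix_mul_rid spinv_left)

lemma spinv_heis: "spinv (heis x y z) = heis (- x) (- y) (- z)"
  by (rule spinv_eqI[OF heis_Sp4]) (simp add: heis_mult heis_zero)

lemma dle_heis: "degree x \<le> n \<Longrightarrow> degree y \<le> n \<Longrightarrow> degree z \<le> n \<Longrightarrow> dle (heis x y z) n"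
  by (auto simp: dle_def heis_def)

lemma dle_blk: "degree a \<le> n \<Longrightarrow> degree b \<le> n \<Longrightarrow> degree c \<le> n \<Longrightarrow> degree d \<le> n \<Longrightarrow> dle (blk a b c d) n"
  by (auto simp: dle_def blk_def)

abbreviation polyT :: "'k::field poly" where "polyT \<equiv> [:0, 1:]"

text \<open>The matrix with rows (T, -1) and (1, 0) has determinant 1 and trace T. The entries of
  its powers are Chebyshev polynomials up to sign, so k letters reach degree k.\<close>

definition hyp :: "'k::field poly^4^4" where
  "hyp = blk polyT (- 1) 1 0"

lemma hyp_gens: "hyp \<in> gens"
  unfolding gens_def hyp_def by (auto intro!: blk_Sp4 dle_blk)

lemma hyp_heis: "hyp ** heis (polyT * x + y) (- x) z = heis x y z ** hyp"
  by (simp add: mat4 heis_def blk_def hyp_def)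

primrec hpow :: "nat \<Rightarrow> 'k::field poly^4^4" where
  "hpow 0 = mat 1"
| "hpow (Suc k) = hyp ** hpow k"

lemma hpow_Suc': "hpow (Suc k) = hpow k ** hyp"
  by (induction k) (simp_all add: matrix_mul_assoc)

lemma len_hpow: "len (hpow k) k"
proof (induction k)
  case (Suc k)
  then show ?case using len_mult[OF len_gen[OF hyp_gens] Suc] by simp
qed (simp add: len_one)

text \<open>Chebyshev polynomials of the second kind, with index shifted by one.\<close>
fun cheb :: "nat \<Rightarrow> 'k::field poly" where
  "cheb 0 = 0"
| "cheb (Suc 0) = 1"
| "cheb (Suc (Suc k)) = polyT * cheb (Suc k) - cheb k"

text \<open>A form that survives the two-step induction: \<open>cheb k\<close> is monic of degree k
  - 1 (zero for k = 0), and nothing is claimed about its lower coefficients.\<close>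

lemma coeff_cheb: "coeff (cheb k) i = (if i + 1 = k then 1 else 0) \<or> i + 1 < k"
proof (induction k arbitrary: i rule: cheb.induct)
  case (3 k)
  show ?case
  proof (cases i)
    case 0 then show ?thesis by auto
  next
    case (Suc j)
    then show ?thesis using "3"(1)[of j] "3"(2)[of i] by (auto simp: coeff_pCons)
  qed
qed auto

lemma coeff_cheb_top: "coeff (cheb (Suc k)) k = 1"
  using coeff_cheb[of "Suc k" k] by auto

lemma coeff_cheb_high: "k \<le> i \<Longrightarrow> coeff (cheb k) i = 0"
  using coeff_cheb[of k i] by auto

text \<open>Conjugation carries (c, 0) along the forward orbit, where the first coordinate has the
  top degree k.\<close>

lemma hpow_heis:
  "hpow k ** heis ([:c:] * cheb (Suc k)) (- ([:c:] * cheb k)) z = heis [:c:] 0 z ** hpow k"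
proof (induction k)
  case (Suc k)
  have "hyp ** heis ([:c:] * cheb (Suc (Suc k))) (- ([:c:] * cheb (Suc k))) z
      = heis ([:c:] * cheb (Suc k)) (- ([:c:] * cheb k)) z ** hyp"
    using hyp_heis[of "[:c:] * cheb (Suc k)" "- ([:c:] * cheb k)" z] by (simp add: algebra_simps)
  then have "(hpow k ** hyp) ** heis ([:c:] * cheb (Suc (Suc k))) (- ([:c:] * cheb (Suc k))) z
      = (hpow k ** heis ([:c:] * cheb (Suc k)) (- ([:c:] * cheb k)) z) ** hyp"
    by (simp only: matrix_mul_assoc[symmetric])
  then show ?case unfolding Suc hpow_Suc' by (simp only: matrix_mul_assoc)
qed simp

text \<open>The backward orbit: here the second coordinate has the top degree k. Forward vectors
  serve to correct x, backward vectors to correct y.\<close>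

lemma heis_hpow:
  "heis (- ([:c:] * cheb k)) ([:c:] * cheb (Suc k)) z ** hpow (Suc k) = hpow (Suc k) ** heis [:c:] 0 z"
proof (induction k)
  case 0
  show ?case using hyp_heis[of 0 "[:c:]" z] by simp
next
  case (Suc k)
  have "heis (- ([:c:] * cheb (Suc k))) ([:c:] * cheb (Suc (Suc k))) z ** hyp
      = hyp ** heis (- ([:c:] * cheb k)) ([:c:] * cheb (Suc k)) z"
    using hyp_heis[of "- ([:c:] * cheb (Suc k))" "[:c:] * cheb (Suc (Suc k))" z]
    by (simp add: algebra_simps)
  then have "heis (- ([:c:] * cheb (Suc k))) ([:c:] * cheb (Suc (Suc k))) z ** (hyp ** hpow (Suc k))
      = hyp ** (heis (- ([:c:] * cheb k)) ([:c:] * cheb (Suc k)) z ** hpow (Suc k))"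
    by (simp only: matrix_mul_assoc)
  then show ?case unfolding Suc hpow.simps(2)[of "Suc k"] by (simp only: matrix_mul_assoc)
qed

lemma heis_const_gens: "heis [:c:] 0 0 \<in> gens"
  unfolding gens_def by (auto intro!: heis_Sp4 dle_heis)

text \<open>A two-sided Horner scheme: every vector of \<open>F[T]\<^sup>2\<close> is a combination, with constant
  coefficients, of the orbit of the first basis vector under the powers of \<open>hyp\<close>, and the conjugating
  powers telescope.\<close>
lemma len_hpow_heis_hpow:
  assumes "\<And>i. k < i \<Longrightarrow> coeff x i = 0" "\<And>i. k \<le> i \<Longrightarrow> coeff y i = 0"
  shows "\<exists>z. len (hpow k ** heis x y z ** hpow k) (4 * k + 1)"
  using assms
proof (induction k arbitrary: x y)
  case 0
  have "x = [:coeff x 0:]" using 0(1) by (intro poly_eqI) (auto simp: coeff_pCons split: nat.splits)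
  moreover have "y = 0" using 0(2) by (intro poly_eqI) auto
  ultimately show ?case using len_gen[OF heis_const_gens[of "coeff x 0"]] by (intro exI[of _ 0]) auto
next
  case (Suc k)
  \<comment> \<open>A forward orbit vector with scalar \<open>c\<close> removes the coefficient of x
    in degree k + 1. This also changes y in degree k, so \<open>d\<close> is read off
    \<open>y1\<close>; the backward vector that removes it touches x only below degree k.\<close>
  define c where "c = coeff x (Suc k)"
  define x1 where "x1 = x - [:c:] * cheb (Suc (Suc k))"
  define y1 where "y1 = y + [:c:] * cheb (Suc k)"
  define d where "d = coeff y1 k"
  define x2 where "x2 = x1 + [:d:] * cheb k"
  define y2 where "y2 = y1 - [:d:] * cheb (Suc k)"
  have "coeff x2 i = 0" if "k < i" for i
  proof (cases "i = Suc k")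
    case True
    then show ?thesis
      by (simp add: x2_def x1_def c_def coeff_cheb_top coeff_cheb_high del: cheb.simps)
  next
    case False
    then show ?thesis using that Suc.prems(1)[of i]
      by (simp add: x2_def x1_def coeff_cheb_high del: cheb.simps)
  qed
  moreover have "coeff y2 i = 0" if "k \<le> i" for i
  proof (cases "i = k")
    case True
    then show ?thesis by (simp add: y2_def d_def coeff_cheb_top del: cheb.simps)
  next
    case False
    then show ?thesis using that Suc.prems(2)[of i]
      by (simp add: y2_def y1_def coeff_cheb_high del: cheb.simps)
  qed
  ultimately obtain z where z: "len (hpow k ** heis x2 y2 z ** hpow k) (4 * k + 1)"
    using Suc.IH[of x2 y2] by blast
  let ?L = "heis ([:c:] * cheb (Suc (Suc k))) (- ([:c:] * cheb (Suc k))) 0"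
  let ?R = "heis (- ([:d:] * cheb k)) ([:d:] * cheb (Suc k)) 0"
  have "[:c:] * cheb (Suc (Suc k)) + x2 + - ([:d:] * cheb k) = x"
    "- ([:c:] * cheb (Suc k)) + y2 + [:d:] * cheb (Suc k) = y"
    by (simp_all add: x2_def x1_def y2_def y1_def del: cheb.simps)
  \<comment> \<open>The central coordinate created by the two products is not controlled here; it is
    only given a name and is repaired in \<open>len_heis\<close>.\<close>
  then obtain w where w: "?L ** heis x2 y2 z ** ?R = heis x y w"
    unfolding heis_mult by metis
  have "hpow (Suc k) ** heis x y w ** hpow (Suc k)
      = (hpow (Suc k) ** ?L) ** heis x2 y2 z ** (?R ** hpow (Suc k))"
    unfolding w[symmetric] by (simp only: matrix_mul_assoc)
  also have "\<dots> = heis [:c:] 0 0 ** hpow (Suc k) ** heis x2 y2 z ** (hpow (Suc k) ** heis [:d:] 0 0)"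
    by (simp only: hpow_heis heis_hpow)
  also have "\<dots> = heis [:c:] 0 0 ** (hyp ** hpow k) ** heis x2 y2 z ** ((hpow k ** hyp) ** heis [:d:] 0 0)"
    by (simp only: hpow_Suc' hpow.simps(2)[symmetric])
  \<comment> \<open>One constant element and one \<open>hyp\<close> remain on each side: every
    further degree costs four letters, whence \<open>4 * k\<close>.\<close>
  also have "\<dots> = (heis [:c:] 0 0 ** hyp) ** (hpow k ** heis x2 y2 z ** hpow k) ** (hyp ** heis [:d:] 0 0)"
    by (simp only: matrix_mul_assoc)
  finally have eq: "hpow (Suc k) ** heis x y w ** hpow (Suc k) = \<dots>" .
  have g: "len (heis [:c:] 0 0 ** hyp) (1 + 1)" "len (hyp ** heis [:d:] 0 0) (1 + 1)"
    by (intro len_mult len_gen hyp_gens heis_const_gens)+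
  show ?case
    by (rule exI[of _ w], subst eq, rule len_mono[OF len_mult[OF len_mult[OF g(1) z] g(2)]]) simp
qed

lemma len_heis_lift:
  assumes "degree x \<le> n" "degree y \<le> n"
  shows "\<exists>z. len (heis x y z) (6 * n + 7)"
proof -
  obtain z where z: "len (hpow (Suc n) ** heis x y z ** hpow (Suc n)) (4 * Suc n + 1)"
    using len_hpow_heis_hpow[of "Suc n" x y] assms by (auto simp: coeff_eq_0)
  have H: "hpow (Suc n) \<in> SP" using len_hpow len_Sp4 by blast
  have "heis x y z = spinv (hpow (Suc n)) ** (hpow (Suc n) ** heis x y z ** hpow (Suc n)) ** spinv (hpow (Suc n))"
    using spinv_left[OF H] spinv_right[OF H] by (metis matrix_mul_assoc matrix_mul_lid matrix_mul_rid)
  then have "len (heis x y z) (Suc n + (4 * Suc n + 1) + Suc n)"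
    by (metis len_mult len_spinv len_hpow z)
  then show ?thesis by (intro exI[of _ z]) (erule len_mono, simp)
qed

text \<open>The commutator with \<open>heis 0 1 0\<close> has central coordinate 2 x, and the
  unknown z of the lift cancels in it; x = t / 2 then produces t.\<close>

lemma len_heis_center:
  fixes t :: "'k::field poly"
  assumes "degree t \<le> n" "(2::'k) \<noteq> 0"
  shows "len (heis 0 0 t) (12 * n + 16)"
proof -
  define x where "x = smult (1/2) t"
  have tx: "t = x + x" using assms(2) by (simp add: x_def smult_add_left[symmetric])
  have "degree x \<le> n" using assms by (simp add: x_def)
  then obtain z where z: "len (heis x 0 z) (6 * n + 7)" using len_heis_lift[of x n 0] by auto
  have c: "heis 0 y 0 \<in> gens" if "degree y = 0" for y :: "'k poly"
    using that unfolding gens_def by (auto intro!: heis_Sp4 dle_heis)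
  have "heis 0 0 t = heis x 0 z ** heis 0 1 0 ** spinv (heis x 0 z) ** heis 0 (- 1) 0"
    by (simp add: spinv_heis heis_mult tx)
  moreover have "len (heis x 0 z ** heis 0 1 0 ** spinv (heis x 0 z) ** heis 0 (- 1) 0) ((6 * n + 7) + 1 + (6 * n + 7) + 1)"
    by (intro len_mult z len_gen c len_spinv) auto
  ultimately show ?thesis by (auto elim: len_mono)
qed

lemma len_heis:
  fixes x y z :: "'k::field poly"
  assumes "degree x \<le> n" "degree y \<le> n" "degree z \<le> n" "(2::'k) \<noteq> 0"
  shows "len (heis x y z) (107 * (n + 1))"
proof -
  obtain w where w: "len (heis x y w) (6 * n + 7)" using len_heis_lift[of x n y] assms by auto
  \<comment> \<open>A word of length m has entries of degree at most m, so even the uncontrolled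
    coordinate has linear degree, and correcting it by the central element \<open>z - w\<close>
    stays affordable: 6 n + 7 + 12 (6 n + 7) + 16 = 78 n + 107.\<close>
  have "degree w \<le> 6 * n + 7" using len_dle[OF w] unfolding dle_def heis_def
    by (auto simp: forall_4 dest: spec[of _ 1])
  then have "degree (z - w) \<le> 6 * n + 7" using assms by (intro degree_diff_le) auto
  from len_mult[OF w len_heis_center[OF this assms(4)]]
  show ?thesis by (auto simp: heis_mult elim: len_mono)
qed

text \<open>Conjugation by it exchanges the root subgroups at the positions (1,4) and (2,3), so the
  bound for the Heisenberg centre also serves the middle block.\<close>

definition weyl :: "'k::field poly^4^4" where
  "weyl = (\<chi> i j. if (i,j) \<in> {(1,2),(2,1),(3,4),(4,3)} then 1 else 0)"

lemma weyl_gens: "weyl \<in> gens"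
  by (simp add: gens_def Sp4_iff mat4 J4_def weyl_def dle_def)

lemma len_blk_upper:
  fixes t :: "'k::field poly"
  assumes "(2::'k) \<noteq> 0"
  shows "len (blk 1 t 0 1) (109 * (degree t + 1))"
proof -
  have "blk 1 t 0 1 = weyl ** heis 0 0 t ** weyl" by (simp add: mat4 blk_def weyl_def heis_def)
  moreover have "len (weyl ** heis 0 0 t ** weyl) (1 + 107 * (degree t + 1) + 1)"
    by (intro len_mult len_gen weyl_gens len_heis assms) auto
  ultimately show ?thesis by (auto elim: len_mono)
qed

lemma len_blk_lower:
  fixes t :: "'k::field poly"
  assumes "(2::'k) \<noteq> 0"
  shows "len (blk 1 0 t 1) (109 * (degree t + 1))"
proof -
  have "transpose (blk 1 t 0 1) = blk 1 0 t 1" by (simp add: mat4 blk_def)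
  then show ?thesis using len_transpose[OF len_blk_upper[OF assms, of t]] by simp
qed

section \<open>Word length and the division algorithm\<close>

lemma degree_poly_div_le:
  fixes a b :: "'k::field poly"
  assumes "b \<noteq> 0"
  shows "degree (a div b) \<le> degree a - degree b"
proof (cases "a div b = 0")
  case False
  have "degree (a div b) + degree b = degree (a - a mod b)"
    using False assms by (simp add: degree_mult_eq[symmetric] minus_mod_eq_div_mult)
  also have "\<dots> \<le> max (degree a) (degree (a mod b))" by (rule degree_diff_le_max)
  finally show ?thesis using degree_mod_less[OF assms, of a] False by (cases "a mod b = 0") auto
qed simp

text \<open>One division costs the degree of the quotient plus one. The degree differences
  telescope, and the extra ones are absorbed by the strict drop of the remainder degrees, which the
  doubled degree of r pays for. Two arbitrary functionals p and r make the statement symmetric, so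
  the recursion can exchange (U, p) with (V, r).\<close>

lemma euclid_reduce:
  fixes U V :: "'k::field poly \<Rightarrow> 'k poly^4^4" and p r :: "'k poly^4^4 \<Rightarrow> 'k poly"
  assumes "\<And>t. len (U t) (K * (degree t + 1))" "\<And>t. len (V t) (K * (degree t + 1))"
    and "\<And>g t. g \<in> X \<Longrightarrow> U t ** g \<in> X \<and> p (U t ** g) = p g + t * r g \<and> r (U t ** g) = r g"
    and "\<And>g t. g \<in> X \<Longrightarrow> V t ** g \<in> X \<and> r (V t ** g) = r g + t * p g \<and> p (V t ** g) = p g"
    and "g \<in> X"
  shows "\<exists>E. len E (K * (degree (p g) + 2 * degree (r g) + 2)) \<and> E ** g \<in> X \<and> (p (E ** g) = 0 \<or> r (E ** g) = 0)"
  using assms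
proof (induction "degree (r g)" arbitrary: U V p r g rule: less_induct)
  case less
  note U = less.prems(1) and V = less.prems(2) and XU = less.prems(3) and XV = less.prems(4) and g = less.prems(5)
  show ?case
  proof (cases "r g = 0")
    case True
    then show ?thesis using g by (intro exI[of _ "mat 1"]) (auto simp: len_one)
  next
    case False
    define q where "q = p g div r g"
    define g' where "g' = U (- q) ** g"
    have g': "g' \<in> X" "p g' = p g mod r g" "r g' = r g"
      using XU[OF g, of "- q"] by (auto simp: g'_def q_def minus_div_mult_eq_mod[symmetric])
    have degq: "degree q \<le> degree (p g) - degree (r g)"
      by (simp add: q_def degree_poly_div_le False)
    have lenU: "len (U (- q)) (K * (degree (p g) - degree (r g) + 1))"
      using degq by (intro len_mono[OF U[of "- q"]] mult_le_mono2) auto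
    show ?thesis
    proof (cases "p g' = 0")
      case True
      have "len (U (- q)) (K * (degree (p g) + 2 * degree (r g) + 2))"
        by (rule len_mono[OF lenU]) (rule mult_le_mono2, simp)
      then show ?thesis using True g' unfolding g'_def by blast
    next
      case ne: False
      have lt: "degree (p g') < degree (r g)" using ne False g' degree_mod_less[of "r g" "p g"] by auto
      from less.hyps[where r = p and p = r and U = V and V = U and g = g', OF lt V U XV XU g'(1)]
      obtain E where E: "len E (K * (degree (r g') + 2 * degree (p g') + 2))" "E ** g' \<in> X"
        "r (E ** g') = 0 \<or> p (E ** g') = 0" by blast
      \<comment> \<open>If p has the smaller degree from the start, the quotient is 0 and the round
        merely swaps the roles.\<close>
      have deg: "degree (p g') \<le> degree (p g)"
        using g'(2) by (cases "degree (p g) < degree (r g)") (use lt g'(3) in \<open>auto simp: mod_poly_less\<close>)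
      have "len (E ** U (- q)) (K * (degree (r g') + 2 * degree (p g') + 2) + K * (degree (p g) - degree (r g) + 1))"
        by (rule len_mult[OF E(1) lenU])
      moreover have "K * (degree (r g') + 2 * degree (p g') + 2) + K * (degree (p g) - degree (r g) + 1)
          = K * ((degree (r g') + 2 * degree (p g') + 2) + (degree (p g) - degree (r g) + 1))"
        by (simp add: algebra_simps)
      moreover have "(degree (r g') + 2 * degree (p g') + 2) + (degree (p g) - degree (r g) + 1)
          \<le> degree (p g) + 2 * degree (r g) + 2"
        using lt g'(3) deg by auto
      ultimately have "len (E ** U (- q)) (K * (degree (p g) + 2 * degree (r g) + 2))"
        by (metis len_mono mult_le_mono2)
      then show ?thesis using E by (intro exI[of _ "E ** U (- q)"]) (auto simp: g'_def matrix_mul_assoc)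
    qed
  qed
qed

text \<open>The cost is linear in the entry degree of the given matrix. Such relations compose,
  because a word of length m raises entry degrees by at most m.\<close>

definition reducible :: "('k::field poly^4^4) set \<Rightarrow> ('k poly^4^4) set \<Rightarrow> bool" where
  "reducible X Y \<longleftrightarrow> (\<exists>K. \<forall>g n. g \<in> X \<and> dle g n \<longrightarrow> (\<exists>E. len E (K * (n + 1)) \<and> E ** g \<in> Y))"

lemma reducibleI:
  "(\<And>g n. g \<in> X \<Longrightarrow> dle g n \<Longrightarrow> \<exists>E. len E (K * (n + 1)) \<and> E ** g \<in> Y) \<Longrightarrow> reducible X Y"
  unfolding reducible_def by blast

lemma reducible_trans [trans]:
  assumes "reducible X Y" "reducible Y Z"
  shows "reducible X Z"
proof -
  obtain K1 where K1: "\<And>g n. g \<in> X \<Longrightarrow> dle g n \<Longrightarrow> \<exists>E. len E (K1 * (n + 1)) \<and> E ** g \<in> Y"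
    using assms(1) unfolding reducible_def by blast
  obtain K2 where K2: "\<And>g n. g \<in> Y \<Longrightarrow> dle g n \<Longrightarrow> \<exists>E. len E (K2 * (n + 1)) \<and> E ** g \<in> Z"
    using assms(2) unfolding reducible_def by blast
  show ?thesis
  proof (rule reducibleI)
    fix g n assume g: "g \<in> X" "dle g n"
    obtain E where E: "len E (K1 * (n + 1))" "E ** g \<in> Y" using K1[OF g] by blast
    have "dle (E ** g) (K1 * (n + 1) + n)" using dle_mult[OF len_dle[OF E(1)] g(2)] .
    then obtain F where F: "len F (K2 * (K1 * (n + 1) + n + 1))" "F ** (E ** g) \<in> Z"
      using K2[OF E(2)] by blast
    have "len (F ** E) (K2 * (K1 * (n + 1) + n + 1) + K1 * (n + 1))" by (rule len_mult[OF F(1) E(1)])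
    then have "len (F ** E) ((K2 * (K1 + 1) + K1) * (n + 1))" by (simp add: algebra_simps)
    then show "\<exists>E. len E ((K2 * (K1 + 1) + K1) * (n + 1)) \<and> E ** g \<in> Z"
      using F(2) by (intro exI[of _ "F ** E"]) (simp add: matrix_mul_assoc)
  qed
qed

lemma reducible_euclid:
  fixes U V :: "'k::field poly \<Rightarrow> 'k poly^4^4"
  assumes U: "\<And>t. len (U t) (K * (degree t + 1))" and V: "\<And>t. len (V t) (K * (degree t + 1))"
    and XU: "\<And>g t. g \<in> X \<Longrightarrow> U t ** g \<in> X \<and> (U t ** g)$i$c = g$i$c + t * g$j$c \<and> (U t ** g)$j$c = g$j$c"
    and XV: "\<And>g t. g \<in> X \<Longrightarrow> V t ** g \<in> X \<and> (V t ** g)$j$c = g$j$c + t * g$i$c \<and> (V t ** g)$i$c = g$i$c"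
  shows "reducible X {g \<in> X. g$j$c = 0}"
proof (rule reducibleI)
  fix g n assume g: "g \<in> X" "dle g n"
  obtain E where E: "len E (K * (degree (g$i$c) + 2 * degree (g$j$c) + 2))" "E ** g \<in> X"
      "(E ** g)$i$c = 0 \<or> (E ** g)$j$c = 0"
    using euclid_reduce[where p = "\<lambda>g. g$i$c" and r = "\<lambda>g. g$j$c", OF U V XU XV g(1)] by blast
  have "degree (g$i$c) + 2 * degree (g$j$c) + 2 \<le> 3 * n + 2"
    using g(2) unfolding dle_def by (metis add_le_mono le_refl mult_le_mono2 add_mult_distrib one_add_one add.commute mult_1 numeral_Bit1 numeral_One)
  then have len: "len E (K * (3 * n + 2))" using E(1) by (meson len_mono mult_le_mono2)
  show "\<exists>E. len E ((4 * K) * (n + 1)) \<and> E ** g \<in> {g \<in> X. g$j$c = 0}"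
  proof (cases "(E ** g)$j$c = 0")
    case True
    have "len E ((4 * K) * (n + 1))" by (rule len_mono[OF len]) (simp add: algebra_simps)
    then show ?thesis using True E by blast
  next
    case False
    \<comment> \<open>The algorithm may stop with the zero in row i. Adding row j to row i and then
      subtracting row i from row j moves it to row j.\<close>
    let ?g1 = "U 1 ** (E ** g)"
    have g1: "?g1 \<in> X" "?g1$i$c = (E ** g)$j$c" "?g1$j$c = (E ** g)$j$c"
      using XU[OF E(2), of 1] E(3) False by auto
    have g2: "V (- 1) ** ?g1 \<in> X" "(V (- 1) ** ?g1)$j$c = 0"
      using XV[OF g1(1), of "- 1"] g1 by auto
    have "len (V (- 1) ** U 1 ** E) (K * (0 + 1) + K * (0 + 1) + K * (3 * n + 2))"
      using U[of 1] V[of "- 1"] by (intro len_mult len) auto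
    then have "len (V (- 1) ** U 1 ** E) ((4 * K) * (n + 1))" 
      by (rule len_mono) (simp add: algebra_simps)
    then show ?thesis using g2 by (intro exI[of _ "V (- 1) ** U 1 ** E"]) (auto simp: matrix_mul_assoc)
  qed
qed

section \<open>Reduction of a symplectic matrix by row operations\<close>

definition col1 :: "'k::field poly^4^4 \<Rightarrow> bool" where
  "col1 g \<longleftrightarrow> g$1$1 = 1 \<and> g$2$1 = 0 \<and> g$3$1 = 0 \<and> g$4$1 = 0"

text \<open>The columns form a symplectic basis. Once some entries are normalised, these relations
  force others to be 0, 1 or units.\<close>

lemma Sp4_form:
  "g \<in> SP \<Longrightarrow> g$1$i * g$4$j + g$2$i * g$3$j - g$3$i * g$2$j - g$4$i * g$1$j = J4$i$j"
proof -
  assume "g \<in> SP"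
  then have "(transpose g ** J4 ** g)$i$j = J4$i$j" by (simp add: Sp4_iff)
  moreover have "(transpose g ** J4 ** g)$i$j = g$1$i * g$4$j + g$2$i * g$3$j - g$3$i * g$2$j - g$4$i * g$1$j"
    by (simp add: matrix_matrix_mult_def sum_4 transpose_def J4_def)
  ultimately show ?thesis by simp
qed

definition tor :: "'k::field \<Rightarrow> 'k poly^4^4" where
  "tor c = (\<chi> i j. if (i,j) = (1,1) then [:c:] else if (i,j) = (4,4) then [:inverse c:] else if i = j then 1 else 0)"

lemma tor_gens: "c \<noteq> 0 \<Longrightarrow> tor c \<in> gens"
  by (simp add: gens_def Sp4_iff mat4 J4_def tor_def dle_def one_pCons)

lemma blk_diag_gens: "c \<noteq> 0 \<Longrightarrow> blk [:c:] 0 0 [:inverse c:] \<in> gens"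
  by (auto simp: gens_def one_pCons intro!: blk_Sp4 dle_blk)

lemma unit_poly_const:
  fixes a b :: "'k::field poly"
  assumes "a * b = 1"
  obtains c where "c \<noteq> 0" "a = [:c:]"
proof -
  have "degree a = 0" using assms
    by (metis add_is_0 degree_1 degree_mult_eq mult_zero_left mult_zero_right zero_neq_one)
  then obtain c where "a = [:c:]" by (rule degree_eq_zeroE)
  then show ?thesis using that assms by force
qed

context
  assumes two: "(2::'k::field) \<noteq> 0"
begin

lemma len_heis1:
  "len (heis 0 0 (t::'k poly)) (109 * (degree t + 1))" "len (heis t 0 0) (109 * (degree t + 1))"
  "len (transpose (heis 0 0 t)) (109 * (degree t + 1))" "len (transpose (heis t 0 0)) (109 * (degree t + 1))"
proof -
  have "len (heis 0 0 t) (107 * (degree t + 1))" "len (heis t 0 0) (107 * (degree t + 1))"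
    by (intro len_heis two; simp)+
  then show a: "len (heis 0 0 t) (109 * (degree t + 1))" "len (heis t 0 0) (109 * (degree t + 1))"
    by (auto elim: len_mono)
  then show "len (transpose (heis 0 0 t)) (109 * (degree t + 1))" "len (transpose (heis t 0 0)) (109 * (degree t + 1))"
    by (auto intro: len_transpose)
qed

lemmas elem_Sp4 = Sp4_mult[OF len_Sp4[OF len_heis1(1)]] Sp4_mult[OF len_Sp4[OF len_heis1(2)]]
  Sp4_mult[OF len_Sp4[OF len_heis1(3)]] Sp4_mult[OF len_Sp4[OF len_heis1(4)]]
  Sp4_mult[OF len_Sp4[OF len_blk_upper[OF two]]] Sp4_mult[OF len_Sp4[OF len_blk_lower[OF two]]]

lemmas elem_entry = matrix_matrix_mult_def sum_4 heis_def blk_def transpose_def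

text \<open>The order of elimination matters. The long root operations on rows 1, 4 and on rows 2, 3
  do not disturb each other, but the short root operation on rows 1, 2 also acts on rows 3, 4 and
  comes last, when the entries there are 0. Pairing columns 1 and 4 then shows that the remaining
  entry is a unit.\<close>

lemma reducible_Sp4_col1: "reducible (SP :: ('k poly^4^4) set) {g \<in> SP. col1 g}"
proof -
  have "reducible (SP :: ('k poly^4^4) set) {g \<in> SP. g$4$1 = 0}"
    by (rule reducible_euclid[where i = 1, OF len_heis1(1) len_heis1(3)])
      (auto simp: elem_Sp4, auto simp: elem_entry)
  also have "reducible {g \<in> SP :: ('k poly^4^4) set. g$4$1 = 0} {g \<in> {g \<in> SP. g$4$1 = 0}. g$3$1 = 0}"
    by (rule reducible_euclid[where i = 2, OF len_blk_upper[OF two] len_blk_lower[OF two]])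
      (auto simp: elem_Sp4, auto simp: elem_entry)
  also have "reducible {g \<in> {g \<in> SP :: ('k poly^4^4) set. g$4$1 = 0}. g$3$1 = 0}
      {g \<in> {g \<in> {g \<in> SP. g$4$1 = 0}. g$3$1 = 0}. g$2$1 = 0}"
    by (rule reducible_euclid[where i = 1, OF len_heis1(2) len_heis1(4)])
      (auto simp: elem_Sp4, auto simp: elem_entry)
  also have "reducible {g \<in> {g \<in> {g \<in> SP :: ('k poly^4^4) set. g$4$1 = 0}. g$3$1 = 0}. g$2$1 = 0} {g \<in> SP. col1 g}"
  proof (rule reducibleI)
    fix g :: "'k poly^4^4" and n
    assume "g \<in> {g \<in> {g \<in> {g \<in> SP. g$4$1 = 0}. g$3$1 = 0}. g$2$1 = 0}"
    then have g: "g \<in> SP" "g$4$1 = 0" "g$3$1 = 0" "g$2$1 = 0" by auto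
    have "g$1$1 * g$4$4 = 1" using Sp4_form[OF g(1), of 1 4] g by (simp add: J4_def)
    then obtain c where c: "c \<noteq> 0" "g$1$1 = [:c:]" by (rule unit_poly_const)
    have t: "tor (inverse c) \<in> gens" using c by (intro tor_gens) simp
    then have "tor (inverse c) ** g \<in> SP" using g by (auto simp: gens_def intro: Sp4_mult)
    moreover have "col1 (tor (inverse c) ** g)"
      using g c by (simp add: col1_def matrix_matrix_mult_def sum_4 tor_def one_pCons)
    moreover have "len (tor (inverse c)) (1 * (n + 1))" by (rule len_mono[OF len_gen[OF t]]) simp
    ultimately show "\<exists>E. len E (1 * (n + 1)) \<and> E ** g \<in> {g \<in> SP. col1 g}" by blast
  qed
  finally show ?thesis .
qed

text \<open>With the first column normalised, row 4 vanishes in columns 2 and 3. The middle block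
  then has determinant 1 and is reduced as in \<open>SL_2\<close>; what is left is a Heisenberg
  element, for which a short word is known.\<close>

lemma reducible_col1_one: "reducible {g \<in> SP :: ('k poly^4^4) set. col1 g} {mat 1}"
proof -
  let ?B = "{g \<in> {g \<in> SP :: ('k poly^4^4) set. col1 g}. g$3$2 = 0}"
  have "reducible {g \<in> SP :: ('k poly^4^4) set. col1 g} ?B"
    by (rule reducible_euclid[where i = 2, OF len_blk_upper[OF two] len_blk_lower[OF two]])
      (auto simp: elem_Sp4, auto simp: elem_entry col1_def)
  also have "reducible ?B {g \<in> ?B. g$2$2 = 1}"
  proof (rule reducibleI)
    fix g :: "'k poly^4^4" and n
    assume g: "g \<in> ?B"
    then have S: "g \<in> SP" by auto
    have "g$4$3 = 0" using g Sp4_form[OF S, of 1 3] by (simp add: J4_def col1_def)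
    moreover have "g$4$2 = 0" using g Sp4_form[OF S, of 1 2] by (simp add: J4_def col1_def)
    ultimately have "g$2$2 * g$3$3 = 1" using g Sp4_form[OF S, of 2 3] by (simp add: J4_def)
    then obtain c where c: "c \<noteq> 0" "g$2$2 = [:c:]" by (rule unit_poly_const)
    let ?t = "blk [:inverse c:] 0 0 [:inverse (inverse c):]"
    have t: "?t \<in> gens" using c by (intro blk_diag_gens) simp
    then have "?t ** g \<in> SP" using S by (auto simp: gens_def intro: Sp4_mult)
    moreover have "col1 (?t ** g)" "(?t ** g)$3$2 = 0" "(?t ** g)$2$2 = 1"
      using g c by (simp_all add: col1_def matrix_matrix_mult_def sum_4 blk_def one_pCons)
    moreover have "len ?t (1 * (n + 1))" by (rule len_mono[OF len_gen[OF t]]) simp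
    ultimately show "\<exists>E. len E (1 * (n + 1)) \<and> E ** g \<in> {g \<in> ?B. g$2$2 = 1}" by blast
  qed
  also have "reducible {g \<in> ?B. g$2$2 = 1} {g \<in> ?B. g$2$2 = 1 \<and> g$2$3 = 0}"
  proof (rule reducibleI)
    fix g :: "'k poly^4^4" and n
    assume g: "g \<in> {g \<in> ?B. g$2$2 = 1}" and n: "dle g n"
    then have S: "g \<in> SP" by auto
    have "g$4$3 = 0" using g Sp4_form[OF S, of 1 3] by (simp add: J4_def col1_def)
    moreover have "g$4$2 = 0" using g Sp4_form[OF S, of 1 2] by (simp add: J4_def col1_def)
    ultimately have g33: "g$3$3 = 1" using g Sp4_form[OF S, of 2 3] by (simp add: J4_def)
    let ?t = "blk 1 (- (g$2$3)) 0 1"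
    have "degree (- (g$2$3)) \<le> n" using n by (simp add: dle_def)
    then have "len ?t (109 * (n + 1))" 
      by (intro len_mono[OF len_blk_upper[OF two]]) simp
    moreover have "?t ** g \<in> SP" using S by (rule elem_Sp4)
    moreover have "col1 (?t ** g)" "(?t ** g)$3$2 = 0" "(?t ** g)$2$2 = 1" "(?t ** g)$2$3 = 0"
      using g g33 by (simp_all add: col1_def matrix_matrix_mult_def sum_4 blk_def)
    ultimately show "\<exists>E. len E (109 * (n + 1)) \<and> E ** g \<in> {g \<in> ?B. g$2$2 = 1 \<and> g$2$3 = 0}" by blast
  qed
  also have "reducible {g \<in> ?B. g$2$2 = 1 \<and> g$2$3 = 0} {mat 1}"
  proof (rule reducibleI)
    fix g :: "'k poly^4^4" and n
    assume g: "g \<in> {g \<in> ?B. g$2$2 = 1 \<and> g$2$3 = 0}" and n: "dle g n"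
    then have S: "g \<in> SP" by auto
    have 4: "g$4$3 = 0" "g$4$2 = 0" "g$4$4 = 1"
      using g Sp4_form[OF S, of 1 3] Sp4_form[OF S, of 1 2] Sp4_form[OF S, of 1 4] by (simp_all add: J4_def col1_def)
    have 3: "g$3$3 = 1" using g 4 Sp4_form[OF S, of 2 3] by (simp add: J4_def)
    have "g$3$4 = - g$1$2" "g$2$4 = g$1$3"
      using g 3 4 Sp4_form[OF S, of 2 4] Sp4_form[OF S, of 3 4] 
      by (simp_all add: J4_def) (simp_all add: add_eq_0_iff)
    then have eq: "g = heis (g$1$2) (g$1$3) (g$1$4)"
      using g 3 4 by (simp add: vec_eq_iff forall_4 heis_def col1_def)
    have "len g (107 * (n + 1))" 
      by (subst eq, intro len_heis two) (use n in \<open>auto simp: dle_def\<close>)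
    then show "\<exists>E. len E (107 * (n + 1)) \<and> E ** g \<in> {mat 1}"
      using spinv_left[OF S] by (intro exI[of _ "spinv g"]) (auto intro: len_spinv)
  qed
  finally show ?thesis .
qed

lemma len_linear:
  "\<exists>K. \<forall>(g::'k poly^4^4) n. g \<in> SP \<and> dle g n \<longrightarrow> len g (K * (n + 1))"
proof -
  have "reducible (SP :: ('k poly^4^4) set) {mat 1}"
    using reducible_Sp4_col1 reducible_col1_one by (rule reducible_trans)
  then obtain K where K: "\<And>(g::'k poly^4^4) n. g \<in> SP \<Longrightarrow> dle g n \<Longrightarrow> \<exists>E. len E (K * (n + 1)) \<and> E ** g = mat 1"
    unfolding reducible_def by blast
  have "len g (K * (n + 1))" if "g \<in> SP" "dle g n" for g :: "'k poly^4^4" and n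
  proof -
    obtain E where E: "len E (K * (n + 1))" "E ** g = mat 1" using K \<open>g \<in> SP\<close> \<open>dle g n\<close> by blast
    then have "g = spinv E" using spinv_eqI[of E g] len_Sp4 by metis
    then show ?thesis using E len_spinv by simp
  qed
  then show ?thesis by blast
qed

end

section \<open>Polynomials of bounded degree\<close>

text \<open>Coefficients instead of the degree, so that n = 0 gives the zero space and the dimension
  is n in every case.\<close>

definition polys_below :: "nat \<Rightarrow> 'k::zero poly set" where
  "polys_below n = {p. \<forall>i\<ge>n. coeff p i = 0}"

lemma polys_below_0: "polys_below 0 = {0}"
  by (auto simp: polys_below_def poly_eq_iff)

lemma polys_below_Suc: "polys_below (Suc n) = (\<lambda>(c, p). pCons c p) ` (UNIV \<times> polys_below n)"
proof (intro equalityI subsetI)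
  fix p :: "'a poly" assume p: "p \<in> polys_below (Suc n)"
  obtain c r where "p = pCons c r" by (cases p)
  with p have "r \<in> polys_below n" by (auto simp: polys_below_def coeff_pCons split: nat.splits)
  with \<open>p = pCons c r\<close> show "p \<in> (\<lambda>(c, p). pCons c p) ` (UNIV \<times> polys_below n)" by auto
next
  fix p :: "'a poly" assume "p \<in> (\<lambda>(c, p). pCons c p) ` (UNIV \<times> polys_below n)"
  then show "p \<in> polys_below (Suc n)" by (auto simp: polys_below_def coeff_pCons split: nat.splits)
qed

lemma card_polys_below: "card (polys_below n :: 'k::{zero,finite} poly set) = CARD('k) ^ n"
  and finite_polys_below: "finite (polys_below n :: 'k poly set)"
proof (induction n)
  case (Suc n)
  case 1
  have "inj_on (\<lambda>(c, p). pCons c p) (UNIV \<times> polys_below n :: ('k \<times> 'k poly) set)"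
    by (auto simp: inj_on_def)
  then show ?case using Suc by (simp add: polys_below_Suc card_image card_cartesian_product)
  case 2
  then show ?case using Suc by (simp add: polys_below_Suc)
qed (auto simp: polys_below_0)

lemma polys_below_iff_degree: "p \<in> polys_below (Suc n) \<longleftrightarrow> degree p \<le> n"
  by (auto simp: polys_below_def Suc_le_eq intro: degree_le coeff_eq_0)

lemma polys_below_closed:
  "0 \<in> polys_below n"
  "p \<in> polys_below n \<Longrightarrow> r \<in> polys_below n \<Longrightarrow> p + r \<in> polys_below n"
  "p \<in> polys_below n \<Longrightarrow> r \<in> polys_below n \<Longrightarrow> p - r \<in> polys_below n"
  "p \<in> polys_below n \<Longrightarrow> smult c p \<in> polys_below n"
  for p r :: "'k::comm_ring_1 poly"
  by (auto simp: polys_below_def)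

section \<open>The length function\<close>

definition minor2 :: "'k::field poly^4^4 \<Rightarrow> 4 \<Rightarrow> 4 \<Rightarrow> 4 \<Rightarrow> 4 \<Rightarrow> 'k poly" where
  "minor2 A i j k l = A$i$k * A$j$l - A$i$l * A$j$k"

text \<open>The entry degree of A on the standard representation and on its exterior square
  together. Both representations are multiplicative, hence the subadditivity.\<close>

definition mdeg :: "'k::field poly^4^4 \<Rightarrow> nat" where
  "mdeg A = Max (range (\<lambda>(i,j). degree (A$i$j)) \<union> range (\<lambda>(i,j,k,l). degree (minor2 A i j k l)))"

lemma mdeg_le_iff:
  "mdeg A \<le> n \<longleftrightarrow> dle A n \<and> (\<forall>i j k l. degree (minor2 A i j k l) \<le> n)"
  unfolding mdeg_def dle_def by (subst Max_le_iff) (auto simp: Ball_def image_iff, blast+)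

text \<open>The Cauchy-Binet formula. Summing over all ordered pairs of indices counts each minor
  product twice, which gives the factor 2.\<close>

lemma minor2_mult:
  "2 * minor2 (A ** B) i j k l = (\<Sum>p\<in>UNIV. \<Sum>r\<in>UNIV. minor2 A i j p r * minor2 B p r k l)"
proof -
  have "(\<Sum>p\<in>UNIV. \<Sum>r\<in>UNIV. minor2 A i j p r * minor2 B p r k l)
     = (\<Sum>p\<in>UNIV. \<Sum>r\<in>UNIV. A$i$p * A$j$r * minor2 B p r k l) - (\<Sum>p\<in>UNIV. \<Sum>r\<in>UNIV. A$i$r * A$j$p * minor2 B p r k l)"
    by (simp add: sum_subtractf[symmetric] minor2_def[of A] left_diff_distrib)
  also have "(\<Sum>p\<in>UNIV. \<Sum>r\<in>UNIV. A$i$r * A$j$p * minor2 B p r k l) = (\<Sum>p\<in>UNIV. \<Sum>r\<in>UNIV. A$i$p * A$j$r * minor2 B r p k l)"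
    by (rule sum.swap)
  also have "\<dots> = - (\<Sum>p\<in>UNIV. \<Sum>r\<in>UNIV. A$i$p * A$j$r * minor2 B p r k l)"
    by (simp add: sum_negf[symmetric] minor2_def algebra_simps)
  also have "(\<Sum>p\<in>UNIV. \<Sum>r\<in>UNIV. A$i$p * A$j$r * minor2 B p r k l) = minor2 (A ** B) i j k l"
    by (simp add: minor2_def matrix_matrix_mult_def sum_product sum_subtractf[symmetric] right_diff_distrib
        mult_ac)
  finally show ?thesis by simp
qed

lemma mdeg_mult:
  fixes A B :: "'k::field poly^4^4"
  assumes two: "(2::'k) \<noteq> 0"
  shows "mdeg (A ** B) \<le> mdeg A + mdeg B"
proof -
  have A: "dle A (mdeg A)" "\<And>i j k l. degree (minor2 A i j k l) \<le> mdeg A"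
    and B: "dle B (mdeg B)" "\<And>i j k l. degree (minor2 B i j k l) \<le> mdeg B"
    using mdeg_le_iff[of A "mdeg A"] mdeg_le_iff[of B "mdeg B"] by auto
  have "degree (minor2 (A ** B) i j k l) \<le> mdeg A + mdeg B" for i j k l
  proof -
    have "minor2 (A ** B) i j k l = smult (1/2) (2 * minor2 (A ** B) i j k l)"
      using two by (simp add: numeral_poly)
    also have "degree \<dots> \<le> degree (2 * minor2 (A ** B) i j k l)" by (rule degree_smult_le)
    also have "\<dots> \<le> mdeg A + mdeg B" unfolding minor2_mult
      by (intro degree_sum_le finite order_trans[OF degree_mult_le] add_mono A B)
    finally show ?thesis .
  qed
  then show ?thesis unfolding mdeg_le_iff using dle_mult[OF A(1) B(1)] by blast
qed

text \<open>The added 1 is for constant matrices other than the identity, which have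
  \<open>mdeg\<close> 0 but positive word length.\<close>

definition ell :: "'k::field poly^4^4 \<Rightarrow> real" where
  "ell A = (if A = mat 1 then 0 else 1 + real (mdeg A))"

lemma ell_mult:
  fixes A B :: "'k::field poly^4^4"
  assumes two: "(2::'k) \<noteq> 0"
  shows "ell (A ** B) \<le> ell A + ell B"
  using mdeg_mult[OF two, of A B] by (auto simp: ell_def)

lemma length_function_ell:
  assumes "(2::'k::field) \<noteq> 0"
  shows "length_function (Sp4 :: ('k poly^4^4) monoid) ell"
  unfolding length_function_def using ell_mult[OF assms] by (auto simp: ell_def)

lemma finite_gens: "finite (gens :: ('k::{field,finite} poly^4^4) set)"
proof -
  let ?F = "(\<lambda>f. \<chi> i j. f (i, j)) ` (UNIV \<rightarrow>\<^sub>E polys_below 2) :: ('k poly^4^4) set"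
  have "A \<in> ?F" if "dle A 1" for A :: "'k poly^4^4"
  proof (rule image_eqI)
    show "A = (\<chi> i j. (\<lambda>(i, j). A$i$j) (i, j))" by (simp add: vec_eq_iff)
    show "(\<lambda>(i, j). A$i$j) \<in> UNIV \<rightarrow>\<^sub>E polys_below 2"
      using that polys_below_iff_degree[of _ 1] by (auto simp: dle_def numeral_2_eq_2)
  qed
  then have "gens \<subseteq> ?F" by (auto simp: gens_def)
  moreover have "finite ?F" by (intro finite_imageI finite_PiE finite_polys_below) auto
  ultimately show ?thesis by (rule finite_subset)
qed

lemma inv_Sp4: "A \<in> SP \<Longrightarrow> inv\<^bsub>Sp4\<^esub> A = spinv A"
  by (rule group.inv_equality[OF group_Sp4]) (auto simp: spinv_left Sp4_spinv)

lemma is_word_gens: "is_word Sp4 gens xs g \<longleftrightarrow> set xs \<subseteq> gens \<and> foldr (**) xs (mat 1) = g"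
  for g :: "'k::field poly^4^4"
proof -
  have "(\<lambda>s. inv\<^bsub>Sp4\<^esub> s) ` gens \<subseteq> (gens :: ('k poly^4^4) set)"
    by (auto simp: gens_def inv_Sp4 Sp4_spinv dle_spinv)
  then have "gens \<union> (\<lambda>s. inv\<^bsub>Sp4\<^esub> s) ` gens = (gens :: ('k poly^4^4) set)" by blast
  then show ?thesis by (simp add: is_word_def)
qed

text \<open>The minors of a generator have degree at most 2, so its length is at most 1 + 2; the
  rest is subadditivity.\<close>

lemma ell_word:
  fixes xs :: "('k::field poly^4^4) list"
  assumes two: "(2::'k) \<noteq> 0" and "set xs \<subseteq> gens"
  shows "ell (foldr (**) xs (mat 1)) \<le> 3 * real (length xs)"
  using assms(2)
proof (induction xs)
  case (Cons s xs)
  have "dle s 1" using Cons.prems by (simp add: gens_def)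
  then have "degree (minor2 s i j k l) \<le> 1 + 1" for i j k l
    unfolding minor2_def dle_def by (intro degree_diff_le order_trans[OF degree_mult_le] add_mono) auto
  then have "mdeg s \<le> 2" using dle_mono[OF \<open>dle s 1\<close>, of 2] by (auto simp: mdeg_le_iff numeral_2_eq_2)
  then have "ell s \<le> 3" by (simp add: ell_def)
  moreover have "ell (foldr (**) (s # xs) (mat 1)) \<le> ell s + ell (foldr (**) xs (mat 1))"
    using ell_mult[OF two] by simp
  ultimately show ?case using Cons by auto
qed (simp add: ell_def)

lemma bilipschitz_ell:
  assumes two: "(2::'k::{field,finite}) \<noteq> 0"
  shows "bilipschitz_to_word_length (Sp4 :: ('k poly^4^4) monoid) ell"
proof -
  obtain K where K: "\<And>(g::'k poly^4^4) n. g \<in> SP \<Longrightarrow> dle g n \<Longrightarrow> len g (K * (n + 1))"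
    using len_linear[OF two] by blast
  have word: "\<exists>xs. length xs \<le> K * (mdeg g + 1) \<and> is_word Sp4 gens xs g" if "g \<in> SP" for g :: "'k poly^4^4"
    using K[OF that, of "mdeg g"] mdeg_le_iff[of g "mdeg g"] by (auto simp: len_def is_word_gens)
  have "ell g \<le> (real K + 3) * real (word_length Sp4 gens g) \<and>
     real (word_length Sp4 gens g) \<le> (real K + 3) * ell g" if g: "g \<in> SP" for g :: "'k poly^4^4"
  proof
    let ?P = "\<lambda>n. \<exists>xs. length xs = n \<and> is_word Sp4 gens xs g"
    obtain xs0 where "is_word Sp4 gens xs0 g" using word[OF g] by blast
    then have "?P (length xs0)" by blast
    then have "?P (word_length Sp4 gens g)"
      unfolding word_length_def by (rule LeastI)
    then obtain xs where xs: "length xs = word_length Sp4 gens g" "set xs \<subseteq> gens" "foldr (**) xs (mat 1) = g"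
      using is_word_gens by blast
    have "ell g \<le> 3 * real (word_length Sp4 gens g)" using ell_word[OF two xs(2)] xs by simp
    also have "\<dots> \<le> (real K + 3) * real (word_length Sp4 gens g)" by (intro mult_right_mono) auto
    finally show "ell g \<le> (real K + 3) * real (word_length Sp4 gens g)" .
    show "real (word_length Sp4 gens g) \<le> (real K + 3) * ell g"
    proof (cases "g = mat 1")
      case True
      have "word_length Sp4 gens g \<le> 0" unfolding word_length_def
        by (rule Least_le) (use True in \<open>auto simp: is_word_gens\<close>)
      then show ?thesis by (simp add: ell_def True)
    next
      case False
      obtain ys where ys: "length ys \<le> K * (mdeg g + 1)" "is_word Sp4 gens ys g" using word[OF g] by blast
      have "word_length Sp4 gens g \<le> length ys" unfolding word_length_def
        by (rule Least_le) (use ys in blast)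
      then have "real (word_length Sp4 gens g) \<le> real (K * (mdeg g + 1))" using ys by linarith
      also have "\<dots> = real K * ell g" using False by (simp add: ell_def algebra_simps)
      also have "\<dots> \<le> (real K + 3) * ell g" by (intro mult_right_mono) (auto simp: ell_def)
      finally show ?thesis .
    qed
  qed
  moreover have "finite_generating_set Sp4 (gens :: ('k poly^4^4) set)"
    unfolding finite_generating_set_def using finite_gens word by (auto simp: gens_def)
  moreover have "0 < real K + 3" by simp
  ultimately show ?thesis unfolding bilipschitz_to_word_length_def by blast
qed

section \<open>Norms of functions on finite abelian subgroups\<close>

lemma has_sum_finite_sum:
  fixes f :: "'i \<Rightarrow> 'a \<Rightarrow> 'b::topological_comm_monoid_add"
  assumes "finite I" "\<And>i. i \<in> I \<Longrightarrow> (f i has_sum s i) A"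
  shows "((\<lambda>x. \<Sum>i\<in>I. f i x) has_sum (\<Sum>i\<in>I. s i)) A"
  using assms by (induction I rule: finite_induct) (auto intro!: has_sum_add has_sum_0)

text \<open>Determinacy of the moment problem on a compact interval: both measures live on [0, C],
  where f is a uniform limit of polynomials.\<close>

lemma measure_eq_integral_of_moments:
  fixes \<mu> \<nu> :: "real measure" and f :: "real \<Rightarrow> real"
  assumes sets: "sets \<mu> = sets borel" "sets \<nu> = sets borel"
    and fin: "finite_measure \<mu>" "finite_measure \<nu>"
    and supp: "emeasure \<mu> (UNIV - {0..C}) = 0" "emeasure \<nu> (UNIV - {0..C}) = 0"
    and int: "\<And>n. integrable \<mu> (\<lambda>t. t ^ n)" "\<And>n. integrable \<nu> (\<lambda>t. t ^ n)"
    and eq: "\<And>n. (\<integral>t. t ^ n \<partial>\<mu>) = (\<integral>t. t ^ n \<partial>\<nu>)"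
    and f: "continuous_on {0..C} f" "f \<in> borel_measurable borel"
  shows "(\<integral>t. f t \<partial>\<mu>) = (\<integral>t. f t \<partial>\<nu>)"
proof -
  have approx: "\<bar>(\<integral>t. f t \<partial>M) - (\<integral>t. g t \<partial>M)\<bar> \<le> e * measure M (space M)"
    if "sets M = sets borel" "finite_measure M" "emeasure M (UNIV - {0..C}) = 0"
      "integrable M g" "\<And>t. t \<in> {0..C} \<Longrightarrow> \<bar>f t - g t\<bar> < e" for M g e
  proof -
    interpret finite_measure M by fact
    have fm: "f \<in> borel_measurable M" using f(2) that(1) by (simp cong: measurable_cong_sets)
    have "UNIV - {0..C} \<in> sets M" using that(1) by simp
    then have ae: "AE t in M. t \<in> {0..C}"
      using that(3) by (intro AE_I[of _ _ "UNIV - {0..C}"]) auto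
    have ae': "AE t in M. \<bar>f t - g t\<bar> \<le> e"
      using ae by eventually_elim (use that(5) in force)
    have intd: "integrable M (\<lambda>t. f t - g t)"
      by (rule integrable_const_bound[where B = e]) (use ae' that(4) fm in auto)
    have "integrable M (\<lambda>t. (f t - g t) + g t)" by (rule Bochner_Integration.integrable_add[OF intd that(4)])
    then have intf: "integrable M f" by simp
    have "\<bar>(\<integral>t. f t \<partial>M) - (\<integral>t. g t \<partial>M)\<bar> = \<bar>\<integral>t. f t - g t \<partial>M\<bar>"
      by (simp add: Bochner_Integration.integral_diff[OF intf that(4)])
    also have "\<dots> \<le> (\<integral>t. \<bar>f t - g t\<bar> \<partial>M)" by (rule integral_abs_bound)
    also have "\<dots> \<le> (\<integral>t. e \<partial>M)"
      by (rule integral_mono_AE) (use intd ae' in auto)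
    finally show ?thesis by (simp add: mult.commute)
  qed
  have "\<bar>(\<integral>t. f t \<partial>\<mu>) - (\<integral>t. f t \<partial>\<nu>)\<bar> \<le> e" if "e > 0" for e
  proof -
    define m where "m = measure \<mu> (space \<mu>) + measure \<nu> (space \<nu>) + 1"
    have m: "m > 0" by (simp add: m_def add_nonneg_pos)
    obtain g where g: "real_polynomial_function g" "\<And>t. t \<in> {0..C} \<Longrightarrow> \<bar>f t - g t\<bar> < e / m"
      by (rule Stone_Weierstrass_real_polynomial_function[OF compact_Icc f(1) divide_pos_pos[OF \<open>e > 0\<close> m]])
        blast
    obtain a n where gs: "g = (\<lambda>t. \<Sum>i\<le>n. a i * t ^ i)"
      using g(1) real_polynomial_function_iff_sum by blast
    have gint: "integrable \<mu> g" "integrable \<nu> g" unfolding gs using int by auto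
    have geq: "(\<integral>t. g t \<partial>\<mu>) = (\<integral>t. g t \<partial>\<nu>)"
      unfolding gs using int eq by (simp add: Bochner_Integration.integral_sum)
    have "\<bar>(\<integral>t. f t \<partial>\<mu>) - (\<integral>t. g t \<partial>\<mu>)\<bar> \<le> e / m * measure \<mu> (space \<mu>)"
      by (rule approx[OF sets(1) fin(1) supp(1) gint(1) g(2)])
    moreover have "\<bar>(\<integral>t. f t \<partial>\<nu>) - (\<integral>t. g t \<partial>\<nu>)\<bar> \<le> e / m * measure \<nu> (space \<nu>)"
      by (rule approx[OF sets(2) fin(2) supp(2) gint(2) g(2)])
    ultimately have "\<bar>(\<integral>t. f t \<partial>\<mu>) - (\<integral>t. f t \<partial>\<nu>)\<bar> \<le> e / m * (m - 1)"
      unfolding geq m_def by (simp add: distrib_left)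
    also have "\<dots> \<le> e / m * m" using m that by (intro mult_left_mono) auto
    also have "\<dots> = e" using m by simp
    finally show ?thesis .
  qed
  then have "\<bar>(\<integral>t. f t \<partial>\<mu>) - (\<integral>t. f t \<partial>\<nu>)\<bar> \<le> 0" by (rule field_le_epsilon[where y = 0, simplified])
  then show ?thesis by simp
qed

text \<open>\<open>Lp_norm\<close> picks a spectral distribution by choice. Its value does not
  depend on the choice, so an explicit distribution may be used to compute it.\<close>

lemma spectral_distribution_integral_unique:
  assumes "spectral_distribution G \<phi> \<mu>" "spectral_distribution G \<phi> \<nu>" "0 < r"
  shows "(\<integral>t. t powr r \<partial>\<mu>) = (\<integral>t. t powr r \<partial>\<nu>)"
proof -
  obtain C D where C: "emeasure \<mu> (UNIV - {0..C}) = 0" and D: "emeasure \<nu> (UNIV - {0..D}) = 0"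
    and s: "sets \<mu> = sets borel" "sets \<nu> = sets borel"
    using assms unfolding spectral_distribution_def by blast
  have "emeasure \<mu> (UNIV - {0..max C D}) \<le> emeasure \<mu> (UNIV - {0..C})"
    by (intro emeasure_mono) (auto simp: s)
  moreover have "emeasure \<nu> (UNIV - {0..max C D}) \<le> emeasure \<nu> (UNIV - {0..D})"
    by (intro emeasure_mono) (auto simp: s)
  ultimately have 0: "emeasure \<mu> (UNIV - {0..max C D}) = 0" "emeasure \<nu> (UNIV - {0..max C D}) = 0"
    using C D by auto
  have cont: "continuous_on {0..max C D} (\<lambda>t::real. t powr r)"
    using assms(3) by (intro continuous_on_powr' continuous_intros) auto
  have moments: "(\<integral>t. t ^ n \<partial>\<mu>) = (\<integral>t. t ^ n \<partial>\<nu>)" for n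
    using assms(1,2) unfolding spectral_distribution_def by (metis of_real_eq_iff)
  have fin: "finite_measure \<mu>" "finite_measure \<nu>"
    and int: "\<And>n. integrable \<mu> (\<lambda>t. t ^ n)" "\<And>n. integrable \<nu> (\<lambda>t. t ^ n)"
    using assms(1,2) unfolding spectral_distribution_def by blast+
  have "(\<lambda>t::real. t powr r) \<in> borel_measurable borel" by measurable
  from measure_eq_integral_of_moments[OF s fin 0 int moments cont this] show ?thesis .
qed

text \<open>A finite abelian group V embedded in G by u, with X indexing its characters. The
  relation \<open>orth\<close> forces X to have as many elements as V, so every character occurs;
  assuming it avoids constructing the dual group.\<close>

locale dual_family =
  fixes G :: "('g, 'b) monoid_scheme" and V :: "'v::ab_group_add set" and u :: "'v \<Rightarrow> 'g"
    and X :: "'x set" and \<theta> :: "'x \<Rightarrow> 'v \<Rightarrow> complex"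
  assumes grp: "group G"
    and finV: "finite V" and zeroV: "0 \<in> V" and diffV: "\<And>v w. v \<in> V \<Longrightarrow> w \<in> V \<Longrightarrow> v - w \<in> V"
    and u_carrier: "\<And>v. v \<in> V \<Longrightarrow> u v \<in> carrier G"
    and u_add: "\<And>v w. v \<in> V \<Longrightarrow> w \<in> V \<Longrightarrow> u (v + w) = u v \<otimes>\<^bsub>G\<^esub> u w"
    and u_inj: "inj_on u V"
    and finX: "finite X"
    and chi_add: "\<And>x v w. x \<in> X \<Longrightarrow> v \<in> V \<Longrightarrow> w \<in> V \<Longrightarrow> \<theta> x (v + w) = \<theta> x v * \<theta> x w"
    and chi_norm: "\<And>x v. x \<in> X \<Longrightarrow> v \<in> V \<Longrightarrow> cmod (\<theta> x v) = 1"
    and orth: "\<And>v. v \<in> V \<Longrightarrow> (\<Sum>x\<in>X. \<theta> x v) = (if v = 0 then of_nat (card V) else 0)"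
begin

sublocale group G by (rule grp)

abbreviation N :: nat where "N \<equiv> card V"

lemma N_pos: "N > 0" using finV zeroV by (auto simp: card_gt_0_iff)

lemma uminusV: "v \<in> V \<Longrightarrow> - v \<in> V" using diffV[OF zeroV] by simp

lemma addV: "v \<in> V \<Longrightarrow> w \<in> V \<Longrightarrow> v + w \<in> V" using diffV[OF _ uminusV] by fastforce

lemma u_zero: "u 0 = \<one>\<^bsub>G\<^esub>"
  using u_add[OF zeroV zeroV] u_carrier[OF zeroV] by (simp add: l_cancel_one)

lemma u_uminus: "v \<in> V \<Longrightarrow> u (- v) = inv\<^bsub>G\<^esub> (u v)"
  using u_add[of "- v" v] by (intro inv_equality[symmetric]) (auto simp: u_zero u_carrier uminusV)

lemma chi_zero: "x \<in> X \<Longrightarrow> \<theta> x 0 = 1"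
  using chi_add[OF _ zeroV zeroV, of x] chi_norm[OF _ zeroV, of x] by auto

lemma chi_uminus: "x \<in> X \<Longrightarrow> v \<in> V \<Longrightarrow> \<theta> x (- v) = cnj (\<theta> x v)"
proof -
  assume *: "x \<in> X" "v \<in> V"
  have "\<theta> x (- v) * \<theta> x v = 1" using chi_add[OF *(1) uminusV[OF *(2)] *(2)] * by (simp add: chi_zero)
  moreover have "cnj (\<theta> x v) * \<theta> x v = 1"
    using chi_norm[OF *] complex_norm_square[of "\<theta> x v"] by (simp add: mult.commute)
  ultimately show ?thesis by (metis mult_cancel_right mult_zero_right zero_neq_one)
qed

lemma card_X: "card X = N"
proof -
  have "(\<Sum>x\<in>X. \<theta> x 0) = of_nat (card X)" by (simp add: chi_zero)
  then show ?thesis using orth[OF zeroV] by (metis of_nat_eq_iff)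
qed

definition ft :: "('v \<Rightarrow> complex) \<Rightarrow> 'x \<Rightarrow> complex" where
  "ft \<zeta> x = (\<Sum>v\<in>V. \<zeta> v * \<theta> x v)"

lemma ft_inversion: "(\<Sum>x\<in>X. ft \<zeta> x) = of_nat N * \<zeta> 0"
proof -
  have "(\<Sum>x\<in>X. ft \<zeta> x) = (\<Sum>v\<in>V. \<zeta> v * (\<Sum>x\<in>X. \<theta> x v))"
    unfolding ft_def by (subst sum.swap) (simp add: sum_distrib_left)
  also have "\<dots> = (\<Sum>v\<in>V. if v = 0 then \<zeta> v * of_nat N else 0)"
    by (intro sum.cong) (auto simp: orth)
  finally show ?thesis using finV zeroV by (simp add: mult.commute)
qed

lemma bij_diffV: "w \<in> V \<Longrightarrow> bij_betw (\<lambda>v. v - w) V V"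
  by (rule bij_betw_byWitness[where f' = "\<lambda>v. v + w"]) (auto simp: diffV addV)

lemma ft_conv:
  assumes x: "x \<in> X"
  shows "ft (\<lambda>w. \<Sum>v\<in>V. \<alpha> v * \<beta> (w - v)) x = ft \<alpha> x * ft \<beta> x"
proof -
  have "ft (\<lambda>w. \<Sum>v\<in>V. \<alpha> v * \<beta> (w - v)) x = (\<Sum>v\<in>V. \<Sum>w\<in>V. \<alpha> v * \<beta> (w - v) * \<theta> x w)"
    unfolding ft_def by (subst sum.swap) (simp add: sum_distrib_right)
  also have "\<dots> = (\<Sum>v\<in>V. \<alpha> v * \<theta> x v * (\<Sum>w\<in>V. \<beta> (w - v) * \<theta> x (w - v)))"
  proof (intro sum.cong refl)
    fix v assume v: "v \<in> V"
    have "\<theta> x w = \<theta> x v * \<theta> x (w - v)" if "w \<in> V" for w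
      using chi_add[OF x v, of "w - v"] that v diffV by simp
    then show "(\<Sum>w\<in>V. \<alpha> v * \<beta> (w - v) * \<theta> x w) = \<alpha> v * \<theta> x v * (\<Sum>w\<in>V. \<beta> (w - v) * \<theta> x (w - v))"
      by (simp add: sum_distrib_left mult_ac)
  qed
  also have "\<dots> = (\<Sum>v\<in>V. \<alpha> v * \<theta> x v * (\<Sum>w\<in>V. \<beta> w * \<theta> x w))"
    by (intro sum.cong refl arg_cong2[where f = "(*)"] sum.reindex_bij_betw[OF bij_diffV]) auto
  finally show ?thesis unfolding ft_def by (simp add: sum_distrib_right)
qed

text \<open>Inversion at 0, applied to the convolution of \<zeta> with its adjoint, whose transform
  is the squared modulus.\<close>

lemma plancherel: "(\<Sum>x\<in>X. (cmod (ft \<zeta> x))\<^sup>2) = real N * (\<Sum>v\<in>V. (cmod (\<zeta> v))\<^sup>2)"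
proof -
  define \<zeta>' where "\<zeta>' = (\<lambda>v. cnj (\<zeta> (- v)))"
  have bij: "bij_betw uminus V V" by (rule bij_betw_byWitness[where f' = uminus]) (auto simp: uminusV)
  have ft': "ft \<zeta>' x = cnj (ft \<zeta> x)" if "x \<in> X" for x
  proof -
    have "ft \<zeta>' x = (\<Sum>v\<in>V. \<zeta>' (- v) * \<theta> x (- v))"
      unfolding ft_def by (rule sum.reindex_bij_betw[OF bij, symmetric])
    also have "\<dots> = cnj (ft \<zeta> x)"
      unfolding ft_def cnj_sum by (intro sum.cong) (auto simp: \<zeta>'_def chi_uminus that)
    finally show ?thesis .
  qed
  have "complex_of_real (\<Sum>x\<in>X. (cmod (ft \<zeta> x))\<^sup>2) = (\<Sum>x\<in>X. ft \<zeta> x * cnj (ft \<zeta> x))"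
    by (simp add: complex_norm_square del: of_real_power)
  also have "\<dots> = (\<Sum>x\<in>X. ft (\<lambda>w. \<Sum>v\<in>V. \<zeta> v * \<zeta>' (w - v)) x)"
    by (intro sum.cong refl) (simp add: ft_conv ft')
  also have "\<dots> = of_nat N * (\<Sum>v\<in>V. \<zeta> v * \<zeta>' (0 - v))" by (rule ft_inversion)
  also have "\<dots> = complex_of_real (real N * (\<Sum>v\<in>V. (cmod (\<zeta> v))\<^sup>2))"
    by (simp add: \<zeta>'_def complex_norm_square del: of_real_power)
  finally show ?thesis by (simp only: of_real_eq_iff)
qed

section \<open>Norms of functions supported on the embedded subgroup\<close>

definition supported :: "('g \<Rightarrow> complex) \<Rightarrow> bool" where
  "supported \<phi> \<longleftrightarrow> (\<forall>g\<in>carrier G. g \<notin> u ` V \<longrightarrow> \<phi> g = 0)"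

abbreviation ftG :: "('g \<Rightarrow> complex) \<Rightarrow> 'x \<Rightarrow> complex" where
  "ftG \<phi> \<equiv> ft (\<lambda>v. \<phi> (u v))"

lemma conv_eq:
  assumes "supported \<phi>"
  shows "conv G \<phi> \<xi> g = (\<Sum>v\<in>V. \<phi> (u v) * \<xi> (u (- v) \<otimes>\<^bsub>G\<^esub> g))"
proof -
  have "conv G \<phi> \<xi> g = (\<Sum>h\<in>u ` V. \<phi> h * \<xi> (inv\<^bsub>G\<^esub> h \<otimes>\<^bsub>G\<^esub> g))"
    unfolding conv_def using assms finV u_carrier
    by (intro sum.mono_neutral_left) (auto simp: supp_def supported_def)
  also have "\<dots> = (\<Sum>v\<in>V. \<phi> (u v) * \<xi> (inv\<^bsub>G\<^esub> (u v) \<otimes>\<^bsub>G\<^esub> g))"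
    by (simp add: sum.reindex[OF u_inj])
  finally show ?thesis by (simp add: u_uminus)
qed

lemma conv_u:
  assumes "supported \<phi>" "w \<in> V"
  shows "conv G \<phi> \<xi> (u w) = (\<Sum>v\<in>V. \<phi> (u v) * \<xi> (u (w - v)))"
  unfolding conv_eq[OF assms(1)]
  by (intro sum.cong refl) (simp add: u_add[symmetric] uminusV assms(2))

lemma supported_conv:
  assumes "supported \<phi>" "supported \<xi>"
  shows "supported (conv G \<phi> \<xi>)"
  unfolding supported_def
proof (intro ballI impI)
  fix g assume g: "g \<in> carrier G" "g \<notin> u ` V"
  have "u (- v) \<otimes>\<^bsub>G\<^esub> g \<notin> u ` V" if v: "v \<in> V" for v
  proof
    assume "u (- v) \<otimes>\<^bsub>G\<^esub> g \<in> u ` V"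
    then obtain w where w: "w \<in> V" "u (- v) \<otimes>\<^bsub>G\<^esub> g = u w" by auto
    then have "g = u v \<otimes>\<^bsub>G\<^esub> u w"
      using g(1) v by (metis inv_solve_left u_carrier u_uminus)
    then show False using g(2) u_add[OF v w(1)] addV[OF v w(1)] by (metis image_eqI)
  qed
  moreover have "u (- v) \<otimes>\<^bsub>G\<^esub> g \<in> carrier G" if "v \<in> V" for v
    using g that by (simp add: u_carrier uminusV)
  ultimately have "\<xi> (u (- v) \<otimes>\<^bsub>G\<^esub> g) = 0" if "v \<in> V" for v
    using assms(2) that unfolding supported_def by blast
  then show "conv G \<phi> \<xi> g = 0" unfolding conv_eq[OF assms(1)] by simp
qed

lemma ftG_conv: "supported \<phi> \<Longrightarrow> x \<in> X \<Longrightarrow> ftG (conv G \<phi> \<xi>) x = ftG \<phi> x * ftG \<xi> x"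
  using ft_conv[of x "\<lambda>v. \<phi> (u v)" "\<lambda>v. \<xi> (u v)"] by (simp add: ft_def conv_u)

lemma supported_adj: "supported \<phi> \<Longrightarrow> supported (adj G \<phi>)"
  unfolding supported_def adj_def
proof (intro ballI impI)
  fix g assume *: "\<forall>g\<in>carrier G. g \<notin> u ` V \<longrightarrow> \<phi> g = 0" "g \<in> carrier G" "g \<notin> u ` V"
  have "inv\<^bsub>G\<^esub> g \<notin> u ` V"
  proof
    assume "inv\<^bsub>G\<^esub> g \<in> u ` V"
    then obtain v where v: "v \<in> V" "inv\<^bsub>G\<^esub> g = u v" by auto
    then have "g = u (- v)" using *(2) by (metis inv_inv u_uminus)
    then show False using *(3) uminusV[OF v(1)] by blast
  qed
  then show "cnj (\<phi> (inv\<^bsub>G\<^esub> g)) = 0" using * by simp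
qed

lemma ftG_adj: "x \<in> X \<Longrightarrow> ftG (adj G \<phi>) x = cnj (ftG \<phi> x)"
proof -
  assume x: "x \<in> X"
  have bij: "bij_betw uminus V V" by (rule bij_betw_byWitness[where f' = uminus]) (auto simp: uminusV)
  have "ftG (adj G \<phi>) x = (\<Sum>v\<in>V. adj G \<phi> (u (- v)) * \<theta> x (- v))"
    unfolding ft_def by (rule sum.reindex_bij_betw[OF bij, symmetric])
  also have "\<dots> = cnj (ftG \<phi> x)"
    unfolding ft_def cnj_sum by (intro sum.cong) (auto simp: adj_def chi_uminus x u_uminus u_carrier)
  finally show ?thesis .
qed

lemma ftG_conv_pow: "supported \<phi> \<Longrightarrow> x \<in> X \<Longrightarrow> ftG (conv_pow G \<phi> n) x = ftG \<phi> x ^ n"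
proof (induction n)
  case 0
  have "ftG (conv_pow G \<phi> 0) x = (\<Sum>v\<in>V. if v = 0 then \<theta> x v else 0)"
    unfolding ft_def using u_inj zeroV u_zero
    by (intro sum.cong) (auto simp: delta_one_def inj_on_def)
  then show ?case using finV zeroV 0 by (simp add: chi_zero)
qed (simp add: ftG_conv)

text \<open>Inversion at 0 turns the trace into the mean over X, and the adjoint becomes complex
  conjugation. The spectral distribution is thus that of the squared modulus of the transform under
  the uniform probability on X.\<close>

lemma tau_moment:
  assumes "supported \<phi>"
  shows "tau G (conv_pow G (conv G (adj G \<phi>) \<phi>) n)
    = complex_of_real ((\<Sum>x\<in>X. ((cmod (ftG \<phi> x))\<^sup>2) ^ n) / N)"
proof -
  let ?\<psi> = "conv G (adj G \<phi>) \<phi>"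
  have s: "supported ?\<psi>" by (intro supported_conv supported_adj assms)
  have "ftG (conv_pow G ?\<psi> n) x = complex_of_real (((cmod (ftG \<phi> x))\<^sup>2) ^ n)" if "x \<in> X" for x
  proof -
    have "ftG ?\<psi> x = complex_of_real ((cmod (ftG \<phi> x))\<^sup>2)"
      using that by (simp add: ftG_conv[OF supported_adj[OF assms]] ftG_adj
        complex_norm_square mult.commute del: of_real_power)
    then show ?thesis using that by (simp only: ftG_conv_pow[OF s] of_real_power)
  qed
  then have "(\<Sum>x\<in>X. ftG (conv_pow G ?\<psi> n) x) = complex_of_real (\<Sum>x\<in>X. ((cmod (ftG \<phi> x))\<^sup>2) ^ n)"
    by simp
  then have "of_nat N * conv_pow G ?\<psi> n (u 0) = complex_of_real (\<Sum>x\<in>X. ((cmod (ftG \<phi> x))\<^sup>2) ^ n)"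
    unfolding ft_inversion .
  then show ?thesis using N_pos by (simp add: tau_def u_zero field_simps)
qed

lemma spectral_distribution_exists:
  assumes "supported \<phi>"
  shows "\<exists>\<mu>. spectral_distribution G \<phi> \<mu> \<and> 
    (\<forall>r. (\<integral>t. t powr r \<partial>\<mu>) = (\<Sum>x\<in>X. (cmod (ftG \<phi> x))\<^sup>2 powr r) / N)"
proof -
  have ne: "X \<noteq> {}" using card_X N_pos by auto
  let ?w = "\<lambda>x. (cmod (ftG \<phi> x))\<^sup>2"
  let ?M = "measure_pmf (pmf_of_set X)"
  define \<mu> where "\<mu> = distr ?M borel ?w"
  have [measurable]: "?w \<in> ?M \<rightarrow>\<^sub>M borel" by simp
  have set: "set_pmf (pmf_of_set X) = X" using ne finX by simp
  have integ: "(\<integral>t. f t \<partial>\<mu>) = (\<Sum>x\<in>X. f (?w x)) / N" if "f \<in> borel_measurable borel" for f :: "real \<Rightarrow> real"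
    using that unfolding \<mu>_def by (subst integral_distr) (auto simp: integral_pmf_of_set[OF ne finX] card_X)
  have "prob_space \<mu>" unfolding \<mu>_def by (intro measure_pmf.prob_space_distr) simp
  moreover have "emeasure \<mu> (UNIV - {0..Max (?w ` X)}) = 0"
  proof -
    have "emeasure \<mu> (UNIV - {0..Max (?w ` X)}) = emeasure ?M (?w -` (UNIV - {0..Max (?w ` X)}))"
      unfolding \<mu>_def by (subst emeasure_distr) auto
    also have "\<dots> = 0"
      using finX by (auto simp: measure_pmf.emeasure_eq_measure measure_pmf_zero_iff set)
    finally show ?thesis .
  qed
  moreover have "integrable \<mu> (\<lambda>t. t ^ n)" for n
    unfolding \<mu>_def by (subst integrable_distr_eq) (auto intro!: integrable_measure_pmf_finite simp: set finX)
  ultimately have "spectral_distribution G \<phi> \<mu>"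
    unfolding spectral_distribution_def tau_moment[OF assms]
    by (auto simp: prob_space.finite_measure integ) (auto simp: \<mu>_def prob_space_def)
  then show ?thesis by (intro exI[of _ \<mu>]) (auto simp: integ)
qed

lemma Lp_norm_eq:
  assumes "supported \<phi>" "p > 0"
  shows "Lp_norm G p \<phi> = ((\<Sum>x\<in>X. cmod (ftG \<phi> x) powr p) / N) powr (1 / p)"
proof -
  obtain \<mu> where \<mu>: "spectral_distribution G \<phi> \<mu>"
    "(\<integral>t. t powr (p/2) \<partial>\<mu>) = (\<Sum>x\<in>X. (cmod (ftG \<phi> x))\<^sup>2 powr (p/2)) / N"
    using spectral_distribution_exists[OF assms(1)] by blast
  have "spectral_distribution G \<phi> (SOME \<mu>. spectral_distribution G \<phi> \<mu>)" using \<mu>(1) by (rule someI)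
  then have "(\<integral>t. t powr (p/2) \<partial>(SOME \<mu>. spectral_distribution G \<phi> \<mu>)) = (\<integral>t. t powr (p/2) \<partial>\<mu>)"
    using \<mu>(1) assms(2) by (intro spectral_distribution_integral_unique) auto
  moreover have "(cmod z)\<^sup>2 powr (p/2) = cmod z powr p" for z
  proof (cases "z = 0")
    case False
    then have "(cmod z)\<^sup>2 = cmod z powr 2" by (subst powr_numeral) auto
    then show ?thesis by (simp only: powr_powr) simp
  qed simp
  ultimately show ?thesis unfolding Lp_norm_def by (simp add: \<mu>(2))
qed

text \<open>Convolution preserves each coset V g and acts there, after Fourier transform, as
  multiplication by \<open>ftG \<phi>\<close>. Summing over all g in G instead of over coset
  representatives counts every coset N times, on both sides of the inequality.\<close>

lemma l2_norm_conv_le: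
  assumes s: "supported \<phi>" and B: "\<And>x. x \<in> X \<Longrightarrow> cmod (ftG \<phi> x) \<le> B" and "0 \<le> B" and l2: "is_l2 G \<xi>"
  shows "l2_norm G (conv G \<phi> \<xi>) \<le> B * l2_norm G \<xi>"
proof -
  define F where "F = (\<lambda>g. (cmod (conv G \<phi> \<xi> g))\<^sup>2)"
  define E where "E = (\<lambda>g. (cmod (\<xi> g))\<^sup>2)"
  have bij: "bij_betw (\<lambda>g. u k \<otimes>\<^bsub>G\<^esub> g) (carrier G) (carrier G)" if "k \<in> V" for k
    by (rule bij_betw_byWitness[where f' = "\<lambda>g. u (- k) \<otimes>\<^bsub>G\<^esub> g"])
      (use that u_carrier in \<open>auto simp: u_uminus m_assoc[symmetric]\<close>)
  have shift: "((\<lambda>g. \<Sum>k\<in>V. H (u k \<otimes>\<^bsub>G\<^esub> g)) has_sum (real N * infsum H (carrier G))) (carrier G)"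
    if "H summable_on carrier G" for H :: "'g \<Rightarrow> real"
  proof -
    have "((\<lambda>g. H (u k \<otimes>\<^bsub>G\<^esub> g)) has_sum infsum H (carrier G)) (carrier G)" if k: "k \<in> V" for k
      using \<open>H summable_on carrier G\<close> summable_on_reindex_bij_betw[OF bij[OF k], of H]
        infsum_reindex_bij_betw[OF bij[OF k], of H] by (metis has_sum_infsum)
    from has_sum_finite_sum[OF finV this] show ?thesis by simp
  qed
  have le: "(\<Sum>k\<in>V. F (u k \<otimes>\<^bsub>G\<^esub> g)) \<le> B\<^sup>2 * (\<Sum>k\<in>V. E (u k \<otimes>\<^bsub>G\<^esub> g))" if g: "g \<in> carrier G" for g
  proof -
    define \<zeta> where "\<zeta> = (\<lambda>v. \<xi> (u v \<otimes>\<^bsub>G\<^esub> g))"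
    define \<omega> where "\<omega> = (\<lambda>w. \<Sum>v\<in>V. \<phi> (u v) * \<zeta> (w - v))"
    have c: "conv G \<phi> \<xi> (u k \<otimes>\<^bsub>G\<^esub> g) = \<omega> k" if "k \<in> V" for k
      unfolding conv_eq[OF s] \<omega>_def \<zeta>_def
    proof (intro sum.cong refl)
      fix v assume v: "v \<in> V"
      have "u (- v) \<otimes>\<^bsub>G\<^esub> (u k \<otimes>\<^bsub>G\<^esub> g) = u (k - v) \<otimes>\<^bsub>G\<^esub> g"
        using u_add[OF uminusV[OF v] that] g u_carrier v that uminusV by (simp add: m_assoc[symmetric])
      then show "\<phi> (u v) * \<xi> (u (- v) \<otimes>\<^bsub>G\<^esub> (u k \<otimes>\<^bsub>G\<^esub> g)) = \<phi> (u v) * \<xi> (u (k - v) \<otimes>\<^bsub>G\<^esub> g)" by simp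
    qed
    have "real N * (\<Sum>k\<in>V. (cmod (\<omega> k))\<^sup>2) = (\<Sum>x\<in>X. (cmod (ft \<omega> x))\<^sup>2)" by (rule plancherel[symmetric])
    also have "\<dots> = (\<Sum>x\<in>X. (cmod (ftG \<phi> x))\<^sup>2 * (cmod (ft \<zeta> x))\<^sup>2)"
      unfolding \<omega>_def by (intro sum.cong refl) (simp add: ft_conv[of _ "\<lambda>v. \<phi> (u v)" \<zeta>] norm_mult power_mult_distrib)
    also have "\<dots> \<le> (\<Sum>x\<in>X. B\<^sup>2 * (cmod (ft \<zeta> x))\<^sup>2)"
      using B by (intro sum_mono mult_right_mono power_mono) auto
    also have "\<dots> = real N * (B\<^sup>2 * (\<Sum>k\<in>V. (cmod (\<zeta> k))\<^sup>2))"
      by (simp add: sum_distrib_left[symmetric] plancherel)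
    finally have "(\<Sum>k\<in>V. (cmod (\<omega> k))\<^sup>2) \<le> B\<^sup>2 * (\<Sum>k\<in>V. (cmod (\<zeta> k))\<^sup>2)" using N_pos by simp
    moreover have "(\<Sum>k\<in>V. F (u k \<otimes>\<^bsub>G\<^esub> g)) = (\<Sum>k\<in>V. (cmod (\<omega> k))\<^sup>2)"
      by (intro sum.cong) (auto simp: F_def c)
    ultimately show ?thesis by (simp add: E_def \<zeta>_def)
  qed
  have Esum: "E summable_on carrier G" using l2 by (simp add: is_l2_def E_def)
  have Ehs: "((\<lambda>g. B\<^sup>2 * (\<Sum>k\<in>V. E (u k \<otimes>\<^bsub>G\<^esub> g))) has_sum (B\<^sup>2 * (real N * infsum E (carrier G)))) (carrier G)"
    by (rule has_sum_cmult_right[OF shift[OF Esum]])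
  have Fsum: "F summable_on carrier G"
  proof (rule summable_on_comparison_test)
    show "(\<lambda>g. B\<^sup>2 * (\<Sum>k\<in>V. E (u k \<otimes>\<^bsub>G\<^esub> g))) summable_on carrier G"
      using Ehs by (rule has_sum_imp_summable)
    fix g assume g: "g \<in> carrier G"
    have "F g = F (u 0 \<otimes>\<^bsub>G\<^esub> g)" using g by (simp add: u_zero)
    also have "\<dots> \<le> (\<Sum>k\<in>V. F (u k \<otimes>\<^bsub>G\<^esub> g))"
      by (rule member_le_sum[OF zeroV]) (auto simp: F_def finV)
    finally show "F g \<le> B\<^sup>2 * (\<Sum>k\<in>V. E (u k \<otimes>\<^bsub>G\<^esub> g))" using le[OF g] by simp
  qed (simp add: F_def)
  have "real N * infsum F (carrier G) \<le> B\<^sup>2 * (real N * infsum E (carrier G))"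
    by (rule has_sum_mono[OF shift[OF Fsum] Ehs]) (rule le)
  then have "infsum F (carrier G) \<le> B\<^sup>2 * infsum E (carrier G)"
    using N_pos by (simp add: mult.left_commute)
  then show ?thesis unfolding l2_norm_def F_def[symmetric] E_def[symmetric]
    using \<open>0 \<le> B\<close> by (metis real_sqrt_le_iff real_sqrt_mult real_sqrt_unique)
qed

lemma cred_norm_le:
  assumes s: "supported \<phi>" and B: "\<And>x. x \<in> X \<Longrightarrow> cmod (ftG \<phi> x) \<le> B" and "0 \<le> B"
  shows "cred_norm G \<phi> \<le> B"
  unfolding cred_norm_def
proof (rule cSup_least)
  show "{l2_norm G (conv G \<phi> \<xi>) |\<xi>. is_l2 G \<xi> \<and> l2_norm G \<xi> \<le> 1} \<noteq> {}"
    by (auto intro!: exI[of _ "\<lambda>_. 0"] simp: is_l2_def l2_norm_def)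
  fix y assume "y \<in> {l2_norm G (conv G \<phi> \<xi>) |\<xi>. is_l2 G \<xi> \<and> l2_norm G \<xi> \<le> 1}"
  then obtain \<xi> where "is_l2 G \<xi>" "l2_norm G \<xi> \<le> 1" "y = l2_norm G (conv G \<phi> \<xi>)" by auto
  then show "y \<le> B" using l2_norm_conv_le[OF assms, of \<xi>] mult_left_le[of "l2_norm G \<xi>" B] assms(3) by linarith
qed

text \<open>The normalised indicator of the image of V is a unit eigenvector whose eigenvalue is the
  sum of the values of \<phi>. That the set of norms is bounded above is part of the argument, since
  a real \<open>Sup\<close> dominates its elements only then.\<close>

lemma cred_norm_ge:
  assumes s: "supported \<phi>"
  shows "cmod (\<Sum>v\<in>V. \<phi> (u v)) \<le> cred_norm G \<phi>"
proof -
  define \<xi> where "\<xi> = (\<lambda>g. if g \<in> u ` V then complex_of_real (1 / sqrt N) else 0)"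
  have cardu: "card (u ` V) = N" by (rule card_image[OF u_inj])
  have sub: "u ` V \<subseteq> carrier G" using u_carrier by auto
  have "((\<lambda>g. (cmod (\<xi> g))\<^sup>2) has_sum (\<Sum>g\<in>u ` V. (cmod (\<xi> g))\<^sup>2)) (carrier G)"
    by (rule has_sum_finite_neutralI) (use finV sub in \<open>auto simp: \<xi>_def\<close>)
  also have "(\<Sum>g\<in>u ` V. (cmod (\<xi> g))\<^sup>2) = (\<Sum>g\<in>u ` V. 1 / N)"
    by (intro sum.cong) (auto simp: \<xi>_def norm_divide power_divide)
  also have "\<dots> = 1" using cardu N_pos by simp
  finally have hs: "((\<lambda>g. (cmod (\<xi> g))\<^sup>2) has_sum 1) (carrier G)" .
  then have \<xi>: "is_l2 G \<xi>" "l2_norm G \<xi> = 1"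
    by (auto simp: is_l2_def l2_norm_def has_sum_imp_summable infsumI)
  have sx: "supported \<xi>" by (simp add: supported_def \<xi>_def)
  let ?S = "\<Sum>v\<in>V. \<phi> (u v)"
  have cu: "conv G \<phi> \<xi> (u w) = ?S * complex_of_real (1 / sqrt N)" if "w \<in> V" for w
    unfolding conv_u[OF s that] by (auto simp: sum_divide_distrib \<xi>_def diffV that intro!: sum.cong)
  have "((\<lambda>g. (cmod (conv G \<phi> \<xi> g))\<^sup>2) has_sum (\<Sum>g\<in>u ` V. (cmod (conv G \<phi> \<xi> g))\<^sup>2)) (carrier G)"
    by (rule has_sum_finite_neutralI) (use finV sub supported_conv[OF s sx] in \<open>auto simp: supported_def\<close>)
  also have "(\<Sum>g\<in>u ` V. (cmod (conv G \<phi> \<xi> g))\<^sup>2) = (\<Sum>g\<in>u ` V. (cmod ?S)\<^sup>2 / N)"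
    by (intro sum.cong) (auto simp: cu norm_mult norm_divide power_mult_distrib power_divide)
  also have "\<dots> = (cmod ?S)\<^sup>2" using cardu N_pos by simp
  finally have "l2_norm G (conv G \<phi> \<xi>) = cmod ?S" by (auto simp: l2_norm_def infsumI)
  moreover have "bdd_above {l2_norm G (conv G \<phi> \<xi>) |\<xi>. is_l2 G \<xi> \<and> l2_norm G \<xi> \<le> 1}"
  proof (rule bdd_aboveI)
    fix y assume "y \<in> {l2_norm G (conv G \<phi> \<xi>) |\<xi>. is_l2 G \<xi> \<and> l2_norm G \<xi> \<le> 1}"
    then obtain \<eta> where \<eta>: "is_l2 G \<eta>" "l2_norm G \<eta> \<le> 1" "y = l2_norm G (conv G \<phi> \<eta>)" by auto
    let ?B = "\<Sum>v\<in>V. cmod (\<phi> (u v))"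
    have B: "cmod (ftG \<phi> x) \<le> ?B" if "x \<in> X" for x
      unfolding ft_def using that by (intro order_trans[OF norm_sum] sum_mono) (auto simp: norm_mult chi_norm)
    have "0 \<le> ?B" by (simp add: sum_nonneg)
    then show "y \<le> ?B" using l2_norm_conv_le[OF s B, of \<eta>] \<eta> mult_left_le[of "l2_norm G \<eta>" ?B] by linarith
  qed
  ultimately show ?thesis unfolding cred_norm_def using \<xi> by (intro cSup_upper) force
qed

section \<open>Testing multipliers on functions lifted from the subgroup\<close>

definition lift :: "('v \<Rightarrow> complex) \<Rightarrow> 'g \<Rightarrow> complex" where
  "lift \<alpha> g = (if g \<in> u ` V then \<alpha> (the_inv_into V u g) else 0)"

lemma lift_u: "v \<in> V \<Longrightarrow> lift \<alpha> (u v) = \<alpha> v"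
  by (simp add: lift_def the_inv_into_f_f[OF u_inj])

lemma supported_mult_lift: "supported (\<lambda>g. f g * lift \<alpha> g)" and supported_lift: "supported (lift \<alpha>)"
  by (simp_all add: supported_def lift_def)

lemma fin_supp_lift: "fin_supp G (lift \<alpha>)"
  unfolding fin_supp_def by (rule finite_subset[of _ "u ` V"]) (auto simp: lift_def finV)

lemma ftG_lift_scaled: "ftG (lift (\<lambda>v. \<alpha> v / of_real D)) x = ft \<alpha> x / of_real D"
  unfolding ft_def sum_divide_distrib by (intro sum.cong) (auto simp: lift_u)

text \<open>The function \<alpha> / B has norm at most 1 by the bound on its transform. After
  multiplication by f, the norm dominates the transform at the trivial character, which is the sum
  in question.\<close>

lemma MCr_estimate:
  assumes "MCr_bounded_by G C f" and B: "\<And>x. x \<in> X \<Longrightarrow> cmod (ft \<alpha> x) \<le> B" and "0 < B"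
  shows "cmod (\<Sum>v\<in>V. f (u v) * \<alpha> v) \<le> C * B"
proof -
  define \<phi> where "\<phi> = lift (\<lambda>v. \<alpha> v / of_real B)"
  have "cred_norm G \<phi> \<le> 1" unfolding \<phi>_def using B \<open>0 < B\<close>
    by (intro cred_norm_le supported_lift) (auto simp: ftG_lift_scaled norm_divide)
  then have C: "cred_norm G (\<lambda>g. f g * \<phi> g) \<le> C"
    using assms(1) fin_supp_lift unfolding MCr_bounded_by_def \<phi>_def by blast
  have "cmod (\<Sum>v\<in>V. f (u v) * \<phi> (u v)) \<le> cred_norm G (\<lambda>g. f g * \<phi> g)"
    unfolding \<phi>_def by (rule cred_norm_ge[OF supported_mult_lift])
  moreover have "(\<Sum>v\<in>V. f (u v) * \<phi> (u v)) = (\<Sum>v\<in>V. f (u v) * \<alpha> v) / of_real B"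
    unfolding sum_divide_distrib \<phi>_def by (intro sum.cong) (auto simp: lift_u)
  ultimately have "cmod (\<Sum>v\<in>V. f (u v) * \<alpha> v) / B \<le> C" using C \<open>0 < B\<close> by (simp add: norm_divide)
  then show ?thesis using \<open>0 < B\<close> by (simp add: field_simps)
qed

text \<open>The Lp norm of the test function is interpolated between its sup norm and its L2 norm;
  the sum of its values is bounded using the atom of the dual group at the trivial character.\<close>
lemma MLp_estimate:
  assumes bdd: "MLp_bounded_by G p C f" and "2 < p"
    and B: "\<And>x. x \<in> X \<Longrightarrow> cmod (ft \<alpha> x) \<le> B" and "0 < B"
    and E: "(\<Sum>v\<in>V. (cmod (\<alpha> v))\<^sup>2) \<le> E" "0 < E"
    and x0: "x0 \<in> X" "\<And>v. v \<in> V \<Longrightarrow> \<theta> x0 v = 1"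
  shows "cmod (\<Sum>v\<in>V. f (u v) * \<alpha> v) \<le> C * (real N * B powr (p - 2) * E) powr (1 / p)"
proof -
  \<comment> \<open>D bounds the Lp norm of \<alpha>: the mean over X of the p-th power of the
    transform is at most B^(p-2) times the mean of its square, which is at most E by
    Plancherel.\<close>
  define D where "D = (B powr (p - 2) * E) powr (1 / p)"
  have D: "0 < D" using \<open>0 < B\<close> \<open>0 < E\<close> by (simp add: D_def)
  have Dp: "D powr p = B powr (p - 2) * E" using \<open>2 < p\<close> \<open>0 < B\<close> \<open>0 < E\<close> by (simp add: D_def powr_powr)
  have N: "0 < real N" using N_pos by simp
  define \<phi> where "\<phi> = lift (\<lambda>v. \<alpha> v / of_real D)"
  have "(\<Sum>x\<in>X. cmod (ft \<alpha> x) powr p) \<le> (\<Sum>x\<in>X. B powr (p - 2) * (cmod (ft \<alpha> x))\<^sup>2)"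
  proof (rule sum_mono)
    fix x assume x: "x \<in> X"
    show "cmod (ft \<alpha> x) powr p \<le> B powr (p - 2) * (cmod (ft \<alpha> x))\<^sup>2"
    proof (cases "ft \<alpha> x = 0")
      case False
      then have "cmod (ft \<alpha> x) powr p = cmod (ft \<alpha> x) powr (p - 2) * cmod (ft \<alpha> x) powr 2"
        by (subst powr_add[symmetric]) simp
      also have "cmod (ft \<alpha> x) powr 2 = (cmod (ft \<alpha> x))\<^sup>2" using False by (subst powr_numeral) auto
      also have "cmod (ft \<alpha> x) powr (p - 2) * (cmod (ft \<alpha> x))\<^sup>2 \<le> B powr (p - 2) * (cmod (ft \<alpha> x))\<^sup>2"
        using B[OF x] \<open>2 < p\<close> by (intro mult_right_mono powr_mono2) auto
      finally show ?thesis .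
    qed simp
  qed
  also have "\<dots> = B powr (p - 2) * (real N * (\<Sum>v\<in>V. (cmod (\<alpha> v))\<^sup>2))"
    by (simp add: sum_distrib_left[symmetric] plancherel)
  also have "\<dots> \<le> B powr (p - 2) * (real N * E)"
    by (intro mult_left_mono E) auto
  also have "\<dots> = real N * D powr p" unfolding Dp by simp
  finally have "(\<Sum>x\<in>X. cmod (ft \<alpha> x) powr p) / D powr p / N \<le> 1"
    using D N by (simp add: field_simps)
  moreover have "(\<Sum>x\<in>X. cmod (ftG \<phi> x) powr p) = (\<Sum>x\<in>X. cmod (ft \<alpha> x) powr p) / D powr p"
    unfolding \<phi>_def ftG_lift_scaled using D by (simp add: norm_divide powr_divide sum_divide_distrib)
  moreover have "0 \<le> (\<Sum>x\<in>X. cmod (ftG \<phi> x) powr p) / N" by (simp add: sum_nonneg)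
  ultimately have "Lp_norm G p \<phi> \<le> 1" using \<open>2 < p\<close>
    unfolding \<phi>_def by (subst Lp_norm_eq[OF supported_lift]) (auto intro!: powr_le1)
  then have C: "Lp_norm G p (\<lambda>g. f g * \<phi> g) \<le> C"
    using bdd fin_supp_lift unfolding MLp_bounded_by_def \<phi>_def by blast
  let ?S = "\<Sum>v\<in>V. f (u v) * \<alpha> v"
  have ft0: "ftG (\<lambda>g. f g * \<phi> g) x0 = ?S / of_real D"
    unfolding ft_def sum_divide_distrib \<phi>_def by (intro sum.cong) (auto simp: lift_u x0)
  \<comment> \<open>Only the trivial character \<open>x0\<close>, of mass 1 / N, is kept; this loses
    the factor N^(1/p).\<close>
  have "(cmod ?S / D) / real N powr (1 / p) = ((cmod ?S / D) powr p / N) powr (1 / p)"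
    using \<open>2 < p\<close> D N by (simp add: powr_divide powr_powr powr_mult)
  also have "\<dots> \<le> ((\<Sum>x\<in>X. cmod (ftG (\<lambda>g. f g * \<phi> g) x) powr p) / N) powr (1 / p)"
  proof (intro powr_mono2 divide_right_mono)
    have "(cmod ?S / D) powr p = cmod (ftG (\<lambda>g. f g * \<phi> g) x0) powr p"
      using D by (simp add: ft0 norm_divide)
    also have "\<dots> \<le> (\<Sum>x\<in>X. cmod (ftG (\<lambda>g. f g * \<phi> g) x) powr p)"
      by (rule member_le_sum[OF x0(1)]) (auto simp: finX)
    finally show "(cmod ?S / D) powr p \<le> (\<Sum>x\<in>X. cmod (ftG (\<lambda>g. f g * \<phi> g) x) powr p)" .
  qed (use \<open>2 < p\<close> in auto)
  also have "\<dots> = Lp_norm G p (\<lambda>g. f g * \<phi> g)"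
    unfolding \<phi>_def using \<open>2 < p\<close> by (subst Lp_norm_eq[OF supported_mult_lift]) auto
  finally have "(cmod ?S / D) / real N powr (1 / p) \<le> C" using C by (rule order_trans)
  then have "cmod ?S \<le> C * (real N powr (1 / p) * D)"
    using D N by (simp add: field_simps)
  also have "real N powr (1 / p) * D = (real N * B powr (p - 2) * E) powr (1 / p)"
    unfolding D_def using \<open>0 < E\<close> by (simp add: powr_mult mult.assoc)
  finally show ?thesis .
qed

end

section \<open>Gauss sums over polynomials\<close>

text \<open>Translation by 1 permutes the field, so comparing the sums of all elements gives q = 0
  in it; with 2 = 0 and q odd this would say 1 = 0.\<close>

lemma two_neq_zero_of_odd_card:
  assumes "odd CARD('k::{field,finite})"
  shows "(2::'k) \<noteq> 0"
proof
  assume two: "(2::'k) = 0"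
  have "(\<Sum>x\<in>UNIV. x) = (\<Sum>x\<in>UNIV. x + 1 :: 'k)"
    by (rule sum.reindex_bij_betw[symmetric, of "\<lambda>x. x + 1" UNIV UNIV "\<lambda>x. x"])
      (rule bij_betw_byWitness[where f' = "\<lambda>x. x - 1"], auto)
  then have "of_nat CARD('k) = (0::'k)" by (simp add: sum.distrib)
  moreover obtain m where "CARD('k) = 2 * m + 1" using assms by (rule oddE)
  ultimately show False using two by simp
qed

lemma cis_2pi_div_neq_1:
  assumes "1 < p"
  shows "cis (2 * pi / real p) \<noteq> 1"
proof
  assume "cis (2 * pi / real p) = 1"
  then have "cos (2 * pi / real p) = 1" by (simp add: complex_eq_iff)
  then obtain n :: nat where "2 * pi / real p = real n * 2 * pi \<or> 2 * pi / real p = - (real n * 2 * pi)"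
    by (auto simp: cos_one_2pi)
  then have "(1 / real p) * (2 * pi) = real n * (2 * pi) \<or> (1 / real p) * (2 * pi) = (- real n) * (2 * pi)"
    by (simp add: mult.assoc)
  then have "1 / real p = real n \<or> 1 / real p = - real n" unfolding mult_cancel_right by simp
  then have "1 = real n * real p \<or> 1 = - (real n * real p)" using assms by (auto simp: field_simps)
  moreover have "0 \<le> real n * real p" by simp
  ultimately have "real (n * p) = 1" by simp
  then have "n * p = 1" by (metis of_nat_1 of_nat_eq_iff)
  then show False using assms by simp
qed

text \<open>Let M be a maximal proper additive subgroup and x outside it. Every y is congruent to a
  multiple \<open>J y\<close> of x modulo M, with \<open>J y\<close> unique modulo p, and a
  primitive p-th root of unity is raised to this power. Multiples are taken with natural numbers, so
  p - 1 stands in for -1.\<close>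

lemma exists_additive_character:
  "\<exists>\<psi> :: 'k::{field,finite} \<Rightarrow> complex.
     (\<forall>x y. \<psi> (x + y) = \<psi> x * \<psi> y) \<and> (\<forall>x. cmod (\<psi> x) = 1) \<and> (\<exists>t. \<psi> t \<noteq> 1)"
proof -
  define p where "p = CHAR('k)"
  have p: "prime p" unfolding p_def by (rule prime_CHAR_semidom) (rule finite_imp_CHAR_pos, simp)
  have of_nat_p: "of_nat n = (0::'k) \<longleftrightarrow> p dvd n" for n
    by (simp add: p_def of_nat_eq_0_iff_char_dvd)
  have minus1: "of_nat (p - 1) = (- 1 :: 'k)"
    using prime_gt_0_nat[OF p] of_nat_p[of p] by (simp add: of_nat_diff)
  define sub where "sub = (\<lambda>M::'k set. 0 \<in> M \<and> (\<forall>x\<in>M. \<forall>y\<in>M. x - y \<in> M))"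
  define Subs where "Subs = {M. sub M \<and> M \<noteq> UNIV}"
  have "finite Subs" by simp
  moreover have "Subs \<noteq> {}"
  proof -
    have "{0::'k} \<noteq> UNIV"
    proof
      assume "{0::'k} = UNIV"
      then have "(1::'k) \<in> {0}" by (simp only: UNIV_I)
      then show False by simp
    qed
    then have "{0} \<in> Subs" unfolding Subs_def mem_Collect_eq by (intro conjI) (simp_all add: sub_def)
    then show ?thesis by (metis empty_iff)
  qed
  ultimately have "\<exists>M\<in>Subs. \<forall>M'\<in>Subs. M \<le> M' \<longrightarrow> M = M'" by (rule finite_has_maximal)
  then obtain M where "M \<in> Subs" and max': "\<forall>M'\<in>Subs. M \<le> M' \<longrightarrow> M = M'" ..
  then have M: "sub M" "M \<noteq> UNIV" by (simp_all add: Subs_def)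
  have max: "M = M'" if "sub M'" "M' \<noteq> UNIV" "M \<subseteq> M'" for M'
    using max' that by (simp add: Subs_def)
  have M0: "0 \<in> M" and Md: "\<And>x y. x \<in> M \<Longrightarrow> y \<in> M \<Longrightarrow> x - y \<in> M" using M(1) by (auto simp: sub_def)
  have Ma: "x + y \<in> M" if "x \<in> M" "y \<in> M" for x y using Md[OF that(1) Md[OF M0 that(2)]] by simp
  have Mn: "of_nat n * x \<in> M" if "x \<in> M" for n x
    by (induction n) (auto simp: M0 distrib_right intro: Ma that)
  obtain x where x: "x \<notin> M" using M(2) by blast
  define M' where "M' = {m + of_nat j * x | m j. m \<in> M}"
  have "sub M'" unfolding sub_def
  proof (intro conjI ballI)
    show "0 \<in> M'" unfolding M'_def using M0 by (auto intro!: exI[of _ 0])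
    fix y z assume "y \<in> M'" "z \<in> M'"
    then obtain m i m' j where *: "y = m + of_nat i * x" "z = m' + of_nat j * x" "m \<in> M" "m' \<in> M"
      unfolding M'_def by auto
    have "y - z = (m - m') + of_nat (i + (p - 1) * j) * x"
      unfolding * of_nat_add of_nat_mult minus1 by (simp add: algebra_simps)
    then show "y - z \<in> M'" unfolding M'_def using Md[OF *(3,4)] by blast
  qed
  moreover have "M \<subseteq> M'" unfolding M'_def by (force intro: exI[of _ 0])
  moreover have "x \<in> M'" unfolding M'_def using M0 by (force intro: exI[of _ 1])
  ultimately have "M' = UNIV" using max x by blast
  then have ex: "\<exists>j. y - of_nat j * x \<in> M" for y
  proof -
    have "y \<in> M'" using \<open>M' = UNIV\<close> by simp
    then obtain m j where "m \<in> M" "y = m + of_nat j * x" unfolding M'_def by auto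
    then show ?thesis by (intro exI[of _ j]) simp
  qed
  define J where "J = (\<lambda>y. SOME j. y - of_nat j * x \<in> M)"
  have J: "y - of_nat (J y) * x \<in> M" for y unfolding J_def by (rule someI_ex[OF ex])
  \<comment> \<open>If the difference e of two coefficients were prime to p, inverting e modulo p
    would put x itself into M.\<close>
  have uniq: "[i = j] (mod p)" if "y - of_nat i * x \<in> M" "y - of_nat j * x \<in> M" for y i j
  proof (rule ccontr)
    assume ncong: "\<not> [i = j] (mod p)"
    define e where "e = i + (p - 1) * j"
    have e: "(of_nat e :: 'k) = of_nat i - of_nat j" unfolding e_def of_nat_add of_nat_mult minus1 by simp
    have eM: "of_nat e * x \<in> M" using Md[OF that(2,1)] unfolding e by (simp add: algebra_simps)
    have "\<not> p dvd e"
    proof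
      assume "p dvd e"
      then have "of_nat i = (of_nat j :: 'k)" using of_nat_p[of e] e by simp
      then show False using ncong by (simp add: of_nat_eq_iff_cong_CHAR p_def)
    qed
    then have "coprime e p" using p by (metis coprime_commute prime_imp_coprime_nat)
    then obtain k where "[e * k = Suc 0] (mod p)" using cong_solve_coprime_nat by blast
    then have "of_nat (e * k) = (of_nat (Suc 0) :: 'k)" by (simp only: of_nat_eq_iff_cong_CHAR p_def)
    then have "of_nat k * (of_nat e * x) = x" by (simp add: mult_ac)
    then show False using Mn[OF eM, of k] x by (simp only:)
  qed
  define \<zeta> where "\<zeta> = cis (2 * pi / real p)"
  have "\<zeta> ^ p = 1" using prime_gt_0_nat[OF p] Complex.DeMoivre[of "2 * pi / real p" p] by (simp add: \<zeta>_def)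
  then have pow: "\<zeta> ^ i = \<zeta> ^ j" if "[i = j] (mod p)" for i j
  proof -
    have red: "\<zeta> ^ n = \<zeta> ^ (n mod p)" for n
    proof -
      have "\<zeta> ^ n = \<zeta> ^ (p * (n div p) + n mod p)" by simp
      also have "\<dots> = \<zeta> ^ (n mod p)" unfolding power_add power_mult \<open>\<zeta> ^ p = 1\<close> by simp
      finally show ?thesis .
    qed
    show ?thesis using red[of i] red[of j] that by (simp add: cong_def)
  qed
  define \<psi> where "\<psi> = (\<lambda>y. \<zeta> ^ J y)"
  have "\<psi> (y + z) = \<psi> y * \<psi> z" for y z
  proof -
    have "(y + z) - of_nat (J y + J z) * x \<in> M"
      using Ma[OF J[of y] J[of z]] by (simp add: algebra_simps)
    from pow[OF uniq[OF J this]] show ?thesis by (simp add: \<psi>_def power_add)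
  qed
  moreover have "cmod (\<psi> y) = 1" for y by (simp add: \<psi>_def \<zeta>_def norm_power)
  moreover have "\<psi> x \<noteq> 1"
  proof -
    have "x - of_nat 1 * x \<in> M" using M0 by simp
    from pow[OF uniq[OF J this]] have "\<psi> x = \<zeta>" by (simp add: \<psi>_def)
    then show ?thesis using cis_2pi_div_neq_1[OF prime_gt_1_nat[OF p]] by (simp add: \<zeta>_def)
  qed
  ultimately show ?thesis by (intro exI[of _ \<psi>]) blast
qed

locale additive_character =
  fixes \<psi> :: "'k::{field,finite} \<Rightarrow> complex"
  assumes psi_add: "\<psi> (x + y) = \<psi> x * \<psi> y" and psi_norm: "cmod (\<psi> x) = 1"
    and psi_nontrivial: "\<exists>t. \<psi> t \<noteq> 1" and two: "(2::'k) \<noteq> 0"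
begin

lemma psi_zero: "\<psi> 0 = 1"
  using psi_add[of 0 0] psi_norm[of 0] by auto

lemma psi_uminus: "\<psi> (- x) = cnj (\<psi> x)"
proof -
  have "\<psi> (- x) * \<psi> x = 1" using psi_add[of "- x" x] by (simp add: psi_zero)
  moreover have "cnj (\<psi> x) * \<psi> x = 1"
    using psi_norm[of x] complex_norm_square[of "\<psi> x"] by (simp add: mult.commute)
  ultimately show ?thesis by (metis mult_cancel_right mult_zero_right zero_neq_one)
qed

lemma psi_diff: "\<psi> (x - y) = \<psi> x * cnj (\<psi> y)"
  using psi_add[of x "- y"] by (simp add: psi_uminus)

text \<open>Translation by b permutes P and multiplies the sum by \<open>\<psi> (l b)\<close>, which
  is not 1.\<close>

lemma char_sum_zero:
  fixes P :: "'v::ab_group_add set"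
  assumes "finite P" "\<And>x. x \<in> P \<Longrightarrow> x + b \<in> P \<and> x - b \<in> P"
    "\<And>x. x \<in> P \<Longrightarrow> l (x + b) = l x + l b" "\<psi> (l b) \<noteq> 1"
  shows "(\<Sum>x\<in>P. \<psi> (l x)) = 0"
proof -
  have bij: "bij_betw (\<lambda>x. x + b) P P"
    by (rule bij_betw_byWitness[where f' = "\<lambda>x. x - b"]) (use assms in auto)
  have "(\<Sum>x\<in>P. \<psi> (l x)) = (\<Sum>x\<in>P. \<psi> (l (x + b)))"
    by (rule sum.reindex_bij_betw[OF bij, symmetric])
  also have "\<dots> = (\<Sum>x\<in>P. \<psi> (l x)) * \<psi> (l b)"
    unfolding sum_distrib_right by (intro sum.cong) (auto simp: assms(3) psi_add)
  finally show ?thesis using assms(4) by (metis mult.right_neutral mult_left_cancel)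
qed

lemma char_sum_zero_poly:
  assumes "b \<in> polys_below n" "l b \<noteq> 0" "\<And>x y. l (x + y) = l x + l y" "\<And>c x. l (smult c x) = c * l x"
  shows "(\<Sum>x\<in>polys_below n. \<psi> (l x)) = 0"
proof -
  obtain t where t: "\<psi> t \<noteq> 1" using psi_nontrivial by blast
  have "l (smult (t / l b) b) = t" using assms by simp
  then show ?thesis using t assms
    by (intro char_sum_zero[where b = "smult (t / l b) b"]) (auto simp: finite_polys_below polys_below_closed)
qed

section \<open>The coefficient pairing, Hankel forms and Gauss sums\<close>

definition pairing :: "nat \<Rightarrow> 'k poly \<Rightarrow> 'k poly \<Rightarrow> 'k" where
  "pairing s \<xi> a = (\<Sum>i\<le>s. coeff \<xi> i * coeff a i)"

lemma pairing_add: "pairing s \<xi> (a + b) = pairing s \<xi> a + pairing s \<xi> b"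
  and pairing_diff: "pairing s \<xi> (a - b) = pairing s \<xi> a - pairing s \<xi> b"
  and pairing_smult: "pairing s \<xi> (smult c a) = c * pairing s \<xi> a"
  by (simp_all add: pairing_def algebra_simps sum.distrib sum_subtractf sum_distrib_left)

lemma pairing_commute: "pairing s \<xi> a = pairing s a \<xi>"
  by (simp add: pairing_def mult.commute)

lemma pairing_monom: "i \<le> s \<Longrightarrow> pairing s \<xi> (monom c i) = coeff \<xi> i * c"
proof -
  assume "i \<le> s"
  have "pairing s \<xi> (monom c i) = (\<Sum>j\<le>s. if j = i then coeff \<xi> i * c else 0)"
    unfolding pairing_def by (intro sum.cong) auto
  then show ?thesis using \<open>i \<le> s\<close> by simp
qed

lemma monom_below: "i < n \<Longrightarrow> monom c i \<in> polys_below n"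
  by (simp add: polys_below_def)

text \<open>In the monomial basis this bilinear form is a Hankel matrix, triangular with respect to the
  antidiagonal through the first nonzero coefficient of \<open>\<xi>\<close>.\<close>
lemma hankel_kernel:
  assumes i0: "coeff \<xi> i0 \<noteq> 0" "\<And>i. i < i0 \<Longrightarrow> coeff \<xi> i = 0" "i0 \<le> s"
    and h: "h \<in> polys_below (Suc s)" "\<And>b. b \<in> polys_below (Suc s) \<Longrightarrow> pairing s \<xi> (poly_shift s (h * b)) = 0"
  shows "h \<in> polys_below i0"
proof (rule ccontr)
  assume ne: "h \<notin> polys_below i0"
  define d where "d = degree h"
  have "h \<noteq> 0" using ne by (auto simp: polys_below_closed)
  have d: "d \<le> s" using h(1) polys_below_iff_degree d_def by auto
  have di: "i0 \<le> d"
  proof (rule ccontr)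
    assume "\<not> i0 \<le> d"
    then have "h \<in> polys_below i0" by (auto simp: polys_below_def d_def intro!: coeff_eq_0)
    with ne show False by simp
  qed
  \<comment> \<open>This exponent puts the leading term of h at position i0 after the shift. The
    lower terms of h land below i0, where \<xi> vanishes, so the pairing is a single nonzero
    product.\<close>
  define b :: "'k poly" where "b = monom 1 (s + i0 - d)"
  have "coeff \<xi> i * coeff (poly_shift s (h * b)) i = (if i = i0 then coeff \<xi> i0 * lead_coeff h else 0)" for i
  proof -
    have c: "coeff (poly_shift s (h * b)) i = (if i + s < s + i0 - d then 0 else coeff h (i + s - (s + i0 - d)))"
      by (simp add: coeff_poly_shift b_def coeff_monom_mult mult.commute[of h])
    consider "i < i0" | "i = i0" | "i0 < i" by linarith
    then show ?thesis
    proof cases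
      case 1 then show ?thesis using i0(2) by simp
    next
      case 2 then show ?thesis using d di c by (simp add: d_def)
    next
      case 3
      then have "coeff h (i + s - (s + i0 - d)) = 0" using d di by (intro coeff_eq_0) (simp add: d_def)
      then show ?thesis using 3 c by simp
    qed
  qed
  then have "pairing s \<xi> (poly_shift s (h * b)) = coeff \<xi> i0 * lead_coeff h"
    unfolding pairing_def using i0(3) by simp
  moreover have "pairing s \<xi> (poly_shift s (h * b)) = 0"
    by (rule h(2)) (use d di in \<open>auto simp: b_def intro!: monom_below\<close>)
  ultimately show False using i0(1) \<open>h \<noteq> 0\<close> by simp
qed

lemma poly_shift_add: "poly_shift n (a + b) = poly_shift n a + poly_shift n b"
  and poly_shift_smult: "poly_shift n (smult c a) = smult c (poly_shift n a)"
  for a b :: "'k poly"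
  by (simp_all add: poly_eq_iff coeff_poly_shift)

definition gauss_sum :: "nat \<Rightarrow> 'k poly \<Rightarrow> 'k poly \<Rightarrow> complex" where
  "gauss_sum s \<xi> \<eta> = (\<Sum>b\<in>polys_below (Suc s). \<psi> (pairing s \<xi> (poly_shift s (b * b)) + pairing s \<eta> b))"

text \<open>Weyl differencing: in the squared modulus the inner sum is a character sum in the linear
  form \<open>2 * B h b'\<close>. It vanishes unless h lies in the kernel of the Hankel form, which
  has at most q^i0 elements, and otherwise is at most q^(s+1).\<close>

lemma gauss_sum_bound:
  assumes i0: "coeff \<xi> i0 \<noteq> 0" "\<And>i. i < i0 \<Longrightarrow> coeff \<xi> i = 0" "i0 \<le> s"
  shows "(cmod (gauss_sum s \<xi> \<eta>))\<^sup>2 \<le> real CARD('k) ^ (Suc s + i0)"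
proof -
  define P where "P = (polys_below (Suc s) :: 'k poly set)"
  define B where "B = (\<lambda>h b. pairing s \<xi> (poly_shift s (h * b)))"
  define Q where "Q = (\<lambda>b. B b b + pairing s \<eta> b)"
  have finP: "finite P" by (simp add: P_def finite_polys_below)
  have cP: "x + y \<in> P" "x - y \<in> P" if "x \<in> P" "y \<in> P" for x y
    using that by (auto simp: P_def polys_below_closed)
  have Badd: "B h (x + y) = B h x + B h y" "B (x + y) h = B x h + B y h" "B h (smult c x) = c * B h x" for h x y c
    by (simp_all add: B_def distrib_left distrib_right poly_shift_add poly_shift_smult pairing_add pairing_smult)
  have Bcomm: "B x y = B y x" for x y by (simp add: B_def mult.commute)
  have "complex_of_real ((cmod (gauss_sum s \<xi> \<eta>))\<^sup>2) = (\<Sum>b\<in>P. \<psi> (Q b)) * cnj (\<Sum>b\<in>P. \<psi> (Q b))"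
    unfolding gauss_sum_def P_def Q_def B_def by (rule complex_norm_square)
  also have "\<dots> = (\<Sum>b'\<in>P. \<Sum>b\<in>P. \<psi> (Q b - Q b'))"
    by (simp add: sum_product psi_diff) (rule sum.swap)
  also have "\<dots> = (\<Sum>b'\<in>P. \<Sum>h\<in>P. \<psi> (Q (h + b') - Q b'))"
  proof (rule sum.cong[OF refl])
    fix b' assume b': "b' \<in> P"
    have "bij_betw (\<lambda>h. h + b') P P"
      by (rule bij_betw_byWitness[where f' = "\<lambda>x. x - b'"]) (use b' cP in auto)
    from sum.reindex_bij_betw[OF this, of "\<lambda>b. \<psi> (Q b - Q b')"]
    show "(\<Sum>b\<in>P. \<psi> (Q b - Q b')) = (\<Sum>h\<in>P. \<psi> (Q (h + b') - Q b'))" by simp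
  qed
  also have "\<dots> = (\<Sum>h\<in>P. \<psi> (Q h) * (\<Sum>b'\<in>P. \<psi> (2 * B h b')))"
  proof -
    have "Q (h + b') - Q b' = Q h + 2 * B h b'" for h b'
      unfolding Q_def Badd pairing_add using Bcomm[of b' h] by (simp add: algebra_simps)
    then show ?thesis by (subst sum.swap) (simp add: psi_add sum_distrib_left)
  qed
  finally have eq: "complex_of_real ((cmod (gauss_sum s \<xi> \<eta>))\<^sup>2) = \<dots>" .
  have inner: "cmod (\<Sum>b'\<in>P. \<psi> (2 * B h b')) \<le> (if h \<in> polys_below i0 then real CARD('k) ^ Suc s else 0)"
    if h: "h \<in> P" for h
  proof (cases "h \<in> polys_below i0")
    case True
    have "cmod (\<Sum>b'\<in>P. \<psi> (2 * B h b')) \<le> (\<Sum>b'\<in>P. 1)"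
      by (rule order_trans[OF norm_sum]) (simp add: psi_norm)
    also have "\<dots> = real CARD('k) ^ Suc s" by (simp add: P_def card_polys_below)
    finally show ?thesis using True by simp
  next
    case False
    then obtain b where b: "b \<in> P" "B h b \<noteq> 0"
      using hankel_kernel[OF i0, of h] h unfolding P_def B_def by blast
    have "(\<Sum>b'\<in>P. \<psi> (2 * B h b')) = 0"
      unfolding P_def by (rule char_sum_zero_poly[where b = b]) (use b two in \<open>auto simp: P_def Badd algebra_simps\<close>)
    then show ?thesis using False by simp
  qed
  have "(cmod (gauss_sum s \<xi> \<eta>))\<^sup>2 = cmod (complex_of_real ((cmod (gauss_sum s \<xi> \<eta>))\<^sup>2))"
    by (simp only: norm_of_real) simp
  also have "\<dots> \<le> (\<Sum>h\<in>P. cmod (\<psi> (Q h) * (\<Sum>b'\<in>P. \<psi> (2 * B h b'))))"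
    unfolding eq by (rule norm_sum)
  also have "\<dots> \<le> (\<Sum>h\<in>P. if h \<in> polys_below i0 then real CARD('k) ^ Suc s else 0)"
    by (rule sum_mono) (simp add: norm_mult psi_norm inner)
  also have "\<dots> = (\<Sum>h\<in>(polys_below i0 :: 'k poly set). real CARD('k) ^ Suc s)"
  proof -
    have "polys_below i0 \<subseteq> P" using i0(3) by (auto simp: P_def polys_below_def)
    then have "P \<inter> polys_below i0 = polys_below i0" by blast
    then show ?thesis using finP by (simp add: sum.If_cases Int_def[symmetric])
  qed
  also have "\<dots> = real CARD('k) ^ (Suc s + i0)" by (simp add: card_polys_below power_add)
  finally show ?thesis .
qed

end

section \<open>Test functions on the abelian unipotent subgroup\<close>

text \<open>The unipotent radical of the Siegel parabolic, abelian with a, b, c as additive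
  coordinates.\<close>

definition umat :: "'k::field poly \<Rightarrow> 'k poly \<Rightarrow> 'k poly \<Rightarrow> 'k poly^4^4" where
  "umat a b c = (\<chi> i j. if i = j then 1 else if (i,j) = (1,3) \<or> (i,j) = (2,4) then b
     else if (i,j) = (1,4) then a else if (i,j) = (2,3) then c else 0)"

lemma umat_Sp4: "umat a b c \<in> SP"
  by (simp add: Sp4_iff mat4 J4_def umat_def)

lemma umat_mult: "umat a b c ** umat a' b' c' = umat (a + a') (b + b') (c + c')"
  by (simp add: mat4 umat_def algebra_simps)

lemma umat_eq_iff: "umat a b c = umat a' b' c' \<longleftrightarrow> a = a' \<and> b = b' \<and> c = c'"
  by (auto simp: mat4 umat_def)

text \<open>Up to sign, the other minors are 0, 1 or entries, so only the one from rows 1, 2 and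
  columns 3, 4 can exceed the entry degrees.\<close>

lemma mdeg_umat:
  assumes "degree a \<le> n" "degree b \<le> n" "degree c \<le> n" "degree (b * b - a * c) = n"
  shows "mdeg (umat a b c) = n"
proof (rule antisym)
  have "degree (a * c - b * b) = n" using assms(4) by (metis degree_minus minus_diff_eq)
  then have "degree (minor2 (umat a b c) i j k l) \<le> n" for i j k l
    using assms exhaust_4[of i] exhaust_4[of j] exhaust_4[of k] exhaust_4[of l]
    by (elim disjE) (simp_all add: minor2_def umat_def mult.commute)
  then show "mdeg (umat a b c) \<le> n"
    unfolding mdeg_le_iff dle_def using assms by (auto simp: umat_def)
  have "minor2 (umat a b c) 1 2 3 4 = b * b - a * c" by (simp add: minor2_def umat_def)
  moreover have "degree (minor2 (umat a b c) 1 2 3 4) \<le> mdeg (umat a b c)"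
    using mdeg_le_iff[of "umat a b c" "mdeg (umat a b c)"] by blast
  ultimately show "n \<le> mdeg (umat a b c)" using assms(4) by simp
qed

context additive_character
begin

text \<open>The last component is a scalar and stands for a multiple of \<open>T^s\<close>. This
  keeps the group order at q^(2s+3), which matters for the Lp estimate because the order enters
  there.\<close>

definition Vset :: "nat \<Rightarrow> ('k poly \<times> 'k poly \<times> 'k) set" where
  "Vset s = polys_below (Suc s) \<times> polys_below (Suc s) \<times> UNIV"

definition usp :: "nat \<Rightarrow> 'k poly \<times> 'k poly \<times> 'k \<Rightarrow> 'k poly^4^4" where
  "usp s v = umat (fst v) (fst (snd v)) (monom (snd (snd v)) s)"

definition phase :: "nat \<Rightarrow> 'k poly \<times> 'k poly \<times> 'k \<Rightarrow> 'k poly \<times> 'k poly \<times> 'k \<Rightarrow> 'k" where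
  "phase s x v = pairing s (fst x) (fst v) + pairing s (fst (snd x)) (fst (snd v)) + snd (snd x) * snd (snd v)"

lemma phase_add: "phase s x (v + w) = phase s x v + phase s x w"
  by (simp add: phase_def pairing_add algebra_simps)

lemma phase_commute: "phase s x v = phase s v x"
  by (simp add: phase_def pairing_commute mult.commute)

lemma card_Vset: "card (Vset s) = CARD('k) ^ (2 * s + 3)"
  by (simp add: Vset_def card_cartesian_product card_polys_below power_add[symmetric] mult_2 numeral_3_eq_3
      flip: power_Suc power_Suc2)

lemma phase_nondegenerate:
  assumes v: "v \<in> Vset s" "v \<noteq> 0"
  shows "\<exists>x\<in>Vset s. phase s v x = t"
proof -
  obtain a b c where abc: "v = (a, b, c)" by (cases v)
  have pz: "pairing s p 0 = 0" for p by (simp add: pairing_def)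
  have nz: "\<exists>p\<in>polys_below (Suc s). pairing s a p = t" if a: "a \<in> polys_below (Suc s)" "a \<noteq> 0" for a
  proof -
    obtain i where i: "coeff a i \<noteq> 0" using a(2) by (metis coeff_0 poly_eqI)
    then have "i \<le> s" using a(1) by (auto simp: polys_below_def not_less_eq_eq[symmetric])
    then have "pairing s a (monom (t / coeff a i) i) = t" using i by (simp add: pairing_monom)
    then show ?thesis using \<open>i \<le> s\<close> monom_below[of i "Suc s"] by (metis le_imp_less_Suc)
  qed
  consider "a \<noteq> 0" | "b \<noteq> 0" | "c \<noteq> 0" using v abc by (auto simp: zero_prod_def)
  then show ?thesis
  proof cases
    case 1
    then obtain p where "p \<in> polys_below (Suc s)" "pairing s a p = t" using nz[of a] v abc by (auto simp: Vset_def)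
    then show ?thesis by (intro bexI[of _ "(p, 0, 0)"]) (auto simp: phase_def abc pz Vset_def polys_below_closed)
  next
    case 2
    then obtain p where "p \<in> polys_below (Suc s)" "pairing s b p = t" using nz[of b] v abc by (auto simp: Vset_def)
    then show ?thesis by (intro bexI[of _ "(0, p, 0)"]) (auto simp: phase_def abc pz Vset_def polys_below_closed)
  next
    case 3
    then show ?thesis by (intro bexI[of _ "(0, 0, t / c)"]) (auto simp: phase_def abc pz Vset_def polys_below_closed)
  qed
qed

lemma finite_Vset: "finite (Vset s)"
  by (simp add: Vset_def finite_polys_below)

lemma Vset_closed: "v \<in> Vset s \<Longrightarrow> w \<in> Vset s \<Longrightarrow> v + w \<in> Vset s" "v \<in> Vset s \<Longrightarrow> w \<in> Vset s \<Longrightarrow> v - w \<in> Vset s"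
  by (auto simp: Vset_def polys_below_closed)

text \<open>The nondegenerate form \<open>phase\<close> identifies the group with its dual, so
  \<open>Vset s\<close> appears in both roles.\<close>

lemma dual_family_Sp4: "dual_family Sp4 (Vset s) (usp s) (Vset s) (\<lambda>x v. \<psi> (phase s x v))"
proof (rule dual_family.intro)
  show "group (Sp4 :: ('k poly^4^4) monoid)" by (rule group_Sp4)
  show "finite (Vset s)" by (rule finite_Vset)
  show "finite (Vset s)" by (rule finite_Vset)
  show "0 \<in> Vset s" by (simp add: Vset_def zero_prod_def polys_below_closed)
  show "inj_on (usp s) (Vset s)" by (auto simp: inj_on_def usp_def umat_eq_iff)
  fix v w :: "'k poly \<times> 'k poly \<times> 'k"
  show "usp s v \<in> SP" by (simp add: usp_def umat_Sp4)
  show "usp s (v + w) = usp s v \<otimes>\<^bsub>Sp4\<^esub> usp s w" by (simp add: usp_def umat_mult add_monom)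
  fix x :: "'k poly \<times> 'k poly \<times> 'k"
  show "\<psi> (phase s x (v + w)) = \<psi> (phase s x v) * \<psi> (phase s x w)" by (simp add: phase_add psi_add)
  show "cmod (\<psi> (phase s x v)) = 1" by (rule psi_norm)
next
  fix v w :: "'k poly \<times> 'k poly \<times> 'k"
  assume "v \<in> Vset s" "w \<in> Vset s"
  then show "v - w \<in> Vset s" by (rule Vset_closed)
next
  fix v :: "'k poly \<times> 'k poly \<times> 'k"
  assume v: "v \<in> Vset s"
  show "(\<Sum>x\<in>Vset s. \<psi> (phase s x v)) = (if v = 0 then of_nat (card (Vset s)) else 0)"
  proof (cases "v = 0")
    case True
    then show ?thesis by (simp add: phase_def psi_zero pairing_def)
  next
    case False
    obtain t where t: "\<psi> t \<noteq> 1" using psi_nontrivial by blast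
    obtain x0 where x0: "x0 \<in> Vset s" "phase s v x0 = t" using phase_nondegenerate[OF v False] by blast
    have "(\<Sum>x\<in>Vset s. \<psi> (phase s v x)) = 0"
      by (rule char_sum_zero[where b = x0]) (use x0 t in \<open>auto simp: finite_Vset Vset_closed phase_add\<close>)
    then show ?thesis using False by (simp add: phase_commute)
  qed
qed

text \<open>For \<open>T^s\<close> in the remaining entry, the 2x2 minor at the upper right corner is
  congruent to \<open>T^s (T^k + w)\<close> modulo polynomials of degree less than \<open>s\<close>.\<close>
definition point :: "nat \<Rightarrow> nat \<Rightarrow> 'k poly \<times> 'k poly \<Rightarrow> 'k poly \<times> 'k poly \<times> 'k" where
  "point s k y = (poly_shift s (fst y * fst y) - monom 1 k - snd y, fst y, 1)"

text \<open>The same parameters are used for k = j and k = j + 1. The two families then have equal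
  size, and their transforms differ only through the factor given by the coefficient of \<xi> in
  degree k.\<close>

definition Yset :: "nat \<Rightarrow> nat \<Rightarrow> ('k poly \<times> 'k poly) set" where
  "Yset s j = polys_below (Suc s) \<times> polys_below j"

lemma card_Yset: "card (Yset s j) = CARD('k) ^ (s + 1 + j)"
  by (simp add: Yset_def card_cartesian_product card_polys_below power_add)

lemma finite_Yset: "finite (Yset s j)"
  by (simp add: Yset_def finite_polys_below)

lemma shift_square_below: "b \<in> polys_below (Suc s) \<Longrightarrow> poly_shift s (b * b) \<in> polys_below (Suc s)"
proof -
  assume "b \<in> polys_below (Suc s)"
  then have "degree (b * b) \<le> s + s" using degree_mult_le[of b b] by (simp add: polys_below_iff_degree)
  then show ?thesis by (auto simp: polys_below_def coeff_poly_shift intro!: coeff_eq_0)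
qed

lemma polys_below_mono: "m \<le> n \<Longrightarrow> p \<in> polys_below m \<Longrightarrow> p \<in> polys_below n"
  by (auto simp: polys_below_def)

lemma point_in_Vset: "y \<in> Yset s j \<Longrightarrow> j \<le> k \<Longrightarrow> k \<le> s \<Longrightarrow> point s k y \<in> Vset s"
proof -
  assume y: "y \<in> Yset s j" and jk: "j \<le> k" "k \<le> s"
  have "poly_shift s (fst y * fst y) \<in> polys_below (Suc s)" "monom 1 k \<in> (polys_below (Suc s) :: 'k poly set)"
    "snd y \<in> polys_below (Suc s)"
    using y jk polys_below_mono[of j "Suc s" "snd y"]
    by (auto simp: Yset_def intro!: shift_square_below monom_below)
  then show ?thesis using y by (auto simp: point_def Vset_def Yset_def polys_below_closed)
qed

lemma inj_point: "inj_on (point s k) A"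
  by (auto simp: inj_on_def point_def prod_eq_iff)

lemma point_disjoint: "point s j ` Yset s j \<inter> point s (Suc j) ` Yset s j = {}"
proof -
  have False if y: "y \<in> Yset s j" "y' \<in> Yset s j" "point s j y = point s (Suc j) y'" for y y'
  proof -
    have "coeff (fst (point s j y)) j = coeff (fst (point s (Suc j) y')) j" using y(3) by (simp only:)
    moreover have "fst y = fst y'" using y(3) by (simp add: point_def)
    ultimately show False using y(1,2) by (auto simp: Yset_def polys_below_def point_def)
  qed
  then show ?thesis by blast
qed

text \<open>As w lies below degree j \<le> k, the factor \<open>T^k + w\<close> is monic of degree k
  for all b and w; hence the length is constant on a family of points.\<close>

lemma ell_usp_point:
  assumes y: "y \<in> Yset s j" and "j \<le> k" "k \<le> s"
  shows "ell (usp s (point s k y)) = 1 + real (s + k)"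
proof -
  obtain b w where bw: "y = (b, w)" "b \<in> polys_below (Suc s)" "w \<in> polys_below j"
    using y by (auto simp: Yset_def)
  define a where "a = poly_shift s (b * b) - monom 1 k - w"
  define W where "W = monom 1 k + w"
  have v: "usp s (point s k y) = umat a b (monom 1 s)" by (simp add: usp_def point_def bw a_def)
  have "a \<in> polys_below (Suc s)"
    using point_in_Vset[OF y assms(2,3)] by (simp add: Vset_def point_def bw a_def)
  then have deg: "degree a \<le> s" "degree b \<le> s" using bw by (simp_all add: polys_below_iff_degree)
  have W: "coeff W k = 1" "\<And>i. i > k \<Longrightarrow> coeff W i = 0"
    using bw(3) \<open>j \<le> k\<close> by (auto simp: W_def polys_below_def)
  define R where "R = b * b - a * monom 1 s"
  have c: "coeff R i = (if i < s then coeff (b * b) i else coeff W (i - s))" for i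
  proof -
    have "coeff (a * monom 1 s) i = (if i < s then 0 else coeff a (i - s))"
      by (simp add: mult.commute[of a] coeff_monom_mult)
    then show ?thesis by (simp add: R_def a_def W_def coeff_poly_shift)
  qed
  have "degree R \<le> s + k"
    by (rule degree_le) (auto simp: c W(2))
  moreover have "s + k \<le> degree R"
    by (rule le_degree) (simp add: c W(1))
  ultimately have "mdeg (umat a b (monom 1 s)) = s + k"
    using deg by (intro mdeg_umat) (auto simp: degree_monom_eq R_def)
  moreover have "umat a b (monom 1 s) \<noteq> mat 1"
    by (auto simp: mat4 umat_def)
  ultimately show ?thesis by (simp add: ell_def v)
qed

text \<open>Left unnormalised: both families have q^(s+1+j) points, and this factor is divided out
  in the decay estimates.\<close>

definition test :: "nat \<Rightarrow> nat \<Rightarrow> 'k poly \<times> 'k poly \<times> 'k \<Rightarrow> complex" where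
  "test s j v = (if v \<in> point s j ` Yset s j then 1 else 0) - (if v \<in> point s (Suc j) ` Yset s j then 1 else 0)"

lemma sum_test:
  assumes "j < s"
  shows "(\<Sum>v\<in>Vset s. g v * test s j v) = (\<Sum>y\<in>Yset s j. g (point s j y)) - (\<Sum>y\<in>Yset s j. g (point s (Suc j) y))"
proof -
  have part: "(\<Sum>v\<in>Vset s. g v * (if v \<in> point s k ` Yset s j then 1 else 0)) = (\<Sum>y\<in>Yset s j. g (point s k y))"
    if "j \<le> k" "k \<le> s" for k
  proof -
    have "point s k ` Yset s j \<subseteq> Vset s" using point_in_Vset that by blast
    then have "Vset s \<inter> point s k ` Yset s j = point s k ` Yset s j" by blast
    then have "(\<Sum>v\<in>Vset s. g v * (if v \<in> point s k ` Yset s j then 1 else 0)) = (\<Sum>v\<in>point s k ` Yset s j. g v)"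
      using sum.inter_restrict[OF finite_Vset, of g s "point s k ` Yset s j"] by (simp add: if_distrib cong: if_cong)
    then show ?thesis by (simp add: sum.reindex[OF inj_point])
  qed
  show ?thesis unfolding test_def right_diff_distrib sum_subtractf
    using part[of j] part[of "Suc j"] assms by simp
qed

lemma sum_test_square:
  assumes "j < s"
  shows "(\<Sum>v\<in>Vset s. (cmod (test s j v))\<^sup>2) = 2 * real CARD('k) ^ (s + 1 + j)"
proof -
  have sub: "point s j ` Yset s j \<union> point s (Suc j) ` Yset s j \<subseteq> Vset s"
    using point_in_Vset[of _ s j] assms by auto
  have "(cmod (test s j v))\<^sup>2 = (if v \<in> point s j ` Yset s j \<union> point s (Suc j) ` Yset s j then 1 else 0)" for v
    using point_disjoint[of s j] by (auto simp: test_def)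
  then have "(\<Sum>v\<in>Vset s. (cmod (test s j v))\<^sup>2) = real (card (point s j ` Yset s j \<union> point s (Suc j) ` Yset s j))"
    using sub finite_Vset[of s] by (simp add: sum.If_cases Int_absorb1 Int_def[symmetric] del: Un_iff)
  also have "card (point s j ` Yset s j \<union> point s (Suc j) ` Yset s j) = card (point s j ` Yset s j) + card (point s (Suc j) ` Yset s j)"
    using point_disjoint finite_Yset by (intro card_Un_disjoint) auto
  finally show ?thesis by (simp add: card_image[OF inj_point] card_Yset)
qed

lemma psi_phase_point:
  assumes "k \<le> s"
  shows "\<psi> (phase s (\<xi>, \<eta>, \<kappa>) (point s k (b, w)))
    = \<psi> \<kappa> * cnj (\<psi> (coeff \<xi> k)) * (\<psi> (pairing s \<xi> (poly_shift s (b * b)) + pairing s \<eta> b) * cnj (\<psi> (pairing s \<xi> w)))"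
proof -
  have "phase s (\<xi>, \<eta>, \<kappa>) (point s k (b, w))
      = (pairing s \<xi> (poly_shift s (b * b)) + pairing s \<eta> b) + \<kappa> - coeff \<xi> k - pairing s \<xi> w"
    using assms by (simp add: phase_def point_def pairing_diff pairing_monom)
  then show ?thesis by (simp only: psi_add psi_diff) (simp add: mult_ac)
qed

lemma sum_psi_phase_point:
  assumes "k \<le> s"
  shows "(\<Sum>y\<in>Yset s j. \<psi> (phase s (\<xi>, \<eta>, \<kappa>) (point s k y)))
    = \<psi> \<kappa> * cnj (\<psi> (coeff \<xi> k)) * (gauss_sum s \<xi> \<eta> * cnj (\<Sum>w\<in>polys_below j. \<psi> (pairing s \<xi> w)))"
proof -
  have "(\<Sum>y\<in>Yset s j. \<psi> (phase s (\<xi>, \<eta>, \<kappa>) (point s k y)))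
      = (\<Sum>(b, w)\<in>polys_below (Suc s) \<times> polys_below j. \<psi> \<kappa> * cnj (\<psi> (coeff \<xi> k)) *
          (\<psi> (pairing s \<xi> (poly_shift s (b * b)) + pairing s \<eta> b) * cnj (\<psi> (pairing s \<xi> w))))"
    unfolding Yset_def by (intro sum.cong refl) (auto simp: psi_phase_point[OF assms])
  also have "\<dots> = \<psi> \<kappa> * cnj (\<psi> (coeff \<xi> k)) * (gauss_sum s \<xi> \<eta> * cnj (\<Sum>w\<in>polys_below j. \<psi> (pairing s \<xi> w)))"
    unfolding gauss_sum_def cnj_sum sum_product by (simp only: sum_distrib_left sum.cartesian_product split_def)
  finally show ?thesis .
qed

text \<open>The modulus of the transform is a product of those of a phase difference E, a Gauss sum
  A and a character sum W over the perturbations w. W is 0 unless \<xi> vanishes below degree j, and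
  E is 0 if the coefficients in degrees j and j + 1 are both 0. Otherwise \<xi> starts in degree j
  or j + 1, exactly where the Gauss sum bound is good.\<close>

lemma ft_test_bound:
  assumes "j < s" "x \<in> Vset s"
  shows "cmod (dual_family.ft (Vset s) (\<lambda>x v. \<psi> (phase s x v)) (test s j) x)
    \<le> 2 * real CARD('k) ^ j * sqrt (real CARD('k) ^ (s + 2 + j))" (is "cmod ?F \<le> ?R")
proof -
  interpret D: dual_family Sp4 "Vset s" "usp s" "Vset s" "\<lambda>x v. \<psi> (phase s x v)" by (rule dual_family_Sp4)
  obtain \<xi> \<eta> \<kappa> where x: "x = (\<xi>, \<eta>, \<kappa>)" by (cases x)
  define A where "A = gauss_sum s \<xi> \<eta>"
  define W where "W = (\<Sum>w\<in>polys_below j. \<psi> (pairing s \<xi> w))"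
  define E where "E = cnj (\<psi> (coeff \<xi> j)) - cnj (\<psi> (coeff \<xi> (Suc j)))"
  have "?F = (\<Sum>v\<in>Vset s. \<psi> (phase s x v) * test s j v)" unfolding D.ft_def by (simp add: mult.commute)
  also have "\<dots> = \<psi> \<kappa> * E * (A * cnj W)"
    using assms unfolding sum_test[OF assms(1)] x E_def A_def W_def by (simp add: sum_psi_phase_point algebra_simps)
  finally have F: "cmod ?F = cmod E * (cmod A * cmod W)" by (simp add: norm_mult psi_norm)
  show ?thesis
  proof (cases "E = 0 \<or> W = 0")
    case True
    then show ?thesis unfolding F by auto
  next
    case False
    have z: "coeff \<xi> i = 0" if "i < j" for i
    proof (rule ccontr)
      assume "coeff \<xi> i \<noteq> 0"
      then have "pairing s \<xi> (monom 1 i) \<noteq> 0" using that assms by (simp add: pairing_monom)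
      then have "W = 0" unfolding W_def
        by (rule char_sum_zero_poly[rotated]) (auto simp: monom_below that pairing_add pairing_smult)
      then show False using False by simp
    qed
    obtain i0 where i0: "i0 \<le> Suc j" "coeff \<xi> i0 \<noteq> 0" "\<And>i. i < i0 \<Longrightarrow> coeff \<xi> i = 0"
    proof (cases "coeff \<xi> j = 0")
      case True
      then have "coeff \<xi> (Suc j) \<noteq> 0" using False by (auto simp: E_def)
      then show ?thesis using that[of "Suc j"] z True by (auto simp: less_Suc_eq)
    qed (use that[of j] z in auto)
    have q: "1 \<le> real CARD('k)" using zero_less_card_finite[where 'a = 'k] by linarith
    have "(cmod A)\<^sup>2 \<le> real CARD('k) ^ (Suc s + i0)"
      unfolding A_def using i0 assms by (intro gauss_sum_bound) auto
    also have "\<dots> \<le> real CARD('k) ^ (s + 2 + j)" using i0(1) q by (intro power_increasing) auto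
    finally have A: "cmod A \<le> sqrt (real CARD('k) ^ (s + 2 + j))" by (rule real_le_rsqrt)
    have "cmod W \<le> (\<Sum>w\<in>(polys_below j :: 'k poly set). 1)" unfolding W_def
      by (rule order_trans[OF norm_sum]) (simp add: psi_norm)
    then have W: "cmod W \<le> real CARD('k) ^ j" by (simp add: card_polys_below)
    have E: "cmod E \<le> 2" unfolding E_def by (rule order_trans[OF norm_triangle_ineq4]) (simp add: psi_norm)
    have "cmod E * (cmod A * cmod W) \<le> 2 * (sqrt (real CARD('k) ^ (s + 2 + j)) * real CARD('k) ^ j)"
      by (intro mult_mono E A W) auto
    then show ?thesis unfolding F by (simp add: mult_ac)
  qed
qed

end

section \<open>Decay of radial multipliers\<close>

lemma power_times_sqrt_power:
  fixes Q :: real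
  assumes "0 < Q"
  shows "Q ^ m * sqrt (Q ^ n) = Q powr (real m + real n / 2)"
proof -
  have "sqrt (Q ^ n) = (Q powr real n) powr (1 / 2)"
    using assms by (simp add: powr_realpow powr_half_sqrt)
  also have "\<dots> = Q powr (real n / 2)" by (simp only: powr_powr) simp
  finally show ?thesis using assms by (simp add: powr_add powr_realpow)
qed

lemma powr_affine:
  fixes Q :: real
  assumes "0 < Q"
  shows "Q powr (real m + c * real n) = Q ^ m * (Q powr c) ^ n"
  using assms by (simp only: powr_add powr_powr[symmetric] powr_realpow powr_gt_zero)

context additive_character
begin

lemma card_gt_1: "1 < real CARD('k)"
proof -
  have "card {0, 1 :: 'k} \<le> CARD('k)" by (rule card_mono) auto
  then show ?thesis by simp
qed

lemma sum_radial_test: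
  fixes f :: "'k poly^4^4 \<Rightarrow> complex"
  assumes "j < s" and f: "radial Sp4 ell f" and g: "g \<in> SP" "ell g = 1 + real (s + j)"
    and h: "h \<in> SP" "ell h = 1 + real (s + Suc j)"
  shows "(\<Sum>v\<in>Vset s. f (usp s v) * test s j v) = of_nat (CARD('k) ^ (s + 1 + j)) * (f g - f h)"
proof -
  have "f (usp s (point s j y)) = f g" if "y \<in> Yset s j" for y
    using f g ell_usp_point[OF that, of j] assms(1) unfolding radial_def
    by (metis less_imp_le order_refl umat_Sp4 usp_def)
  moreover have "f (usp s (point s (Suc j) y)) = f h" if "y \<in> Yset s j" for y
    using f h ell_usp_point[OF that, of "Suc j"] assms(1) unfolding radial_def
    by (metis Suc_leI le_SucI order_refl umat_Sp4 usp_def)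
  ultimately show ?thesis
    unfolding sum_test[OF assms(1), of "\<lambda>v. f (usp s v)"] by (simp add: card_Yset algebra_simps)
qed

text \<open>The transform bound divided by the size q^(s+1+j) of a level set leaves 2
  q^(-(s-j)/2).\<close>

lemma MCr_level_decay:
  fixes f :: "'k poly^4^4 \<Rightarrow> complex"
  assumes bdd: "MCr_bounded_by Sp4 C f" and f: "radial Sp4 ell f" and "j < s"
    and g: "g \<in> SP" "ell g = 1 + real (s + j)" and h: "h \<in> SP" "ell h = 1 + real (s + Suc j)"
  shows "cmod (f g - f h) \<le> C * 2 * (real CARD('k) powr (- 1 / 2)) ^ (s - j)"
proof -
  interpret D: dual_family Sp4 "Vset s" "usp s" "Vset s" "\<lambda>x v. \<psi> (phase s x v)" by (rule dual_family_Sp4)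
  define Q where "Q = real CARD('k)"
  have Q: "1 < Q" using card_gt_1 by (simp add: Q_def)
  let ?B = "2 * Q ^ j * sqrt (Q ^ (s + 2 + j))"
  have "cmod (\<Sum>v\<in>Vset s. f (usp s v) * test s j v) \<le> C * ?B"
    by (rule D.MCr_estimate[OF bdd]) (use ft_test_bound[OF \<open>j < s\<close>] Q in \<open>auto simp: Q_def\<close>)
  then have "Q ^ (s + 1 + j) * cmod (f g - f h) \<le> C * ?B"
    unfolding sum_radial_test[OF \<open>j < s\<close> f g h] by (simp add: norm_mult norm_power Q_def)
  also have "?B = Q ^ (s + 1 + j) * (2 * (Q powr (- 1 / 2)) ^ (s - j))"
  proof -
    have "Q ^ j * sqrt (Q ^ (s + 2 + j)) = Q powr (real j + real (s + 2 + j) / 2)"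
      using Q by (intro power_times_sqrt_power) simp
    also have "real j + real (s + 2 + j) / 2 = real (s + 1 + j) + (- 1 / 2) * real (s - j)"
      using \<open>j < s\<close> by (simp add: of_nat_diff field_simps)
    also have "Q powr \<dots> = Q ^ (s + 1 + j) * (Q powr (- 1 / 2)) ^ (s - j)"
      using Q by (intro powr_affine) simp
    finally show ?thesis by simp
  qed
  also have "C * (Q ^ (s + 1 + j) * (2 * (Q powr (- 1 / 2)) ^ (s - j)))
      = Q ^ (s + 1 + j) * (C * 2 * (Q powr (- 1 / 2)) ^ (s - j))" by (simp only: mult_ac)
  finally show ?thesis using Q by (simp add: Q_def)
qed

lemma MLp_level_decay:
  fixes f :: "'k poly^4^4 \<Rightarrow> complex"
  assumes "4 < p"
    and bdd: "MLp_bounded_by Sp4 p C f" and f: "radial Sp4 ell f" and "j < s"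
    and g: "g \<in> SP" "ell g = 1 + real (s + j)" and h: "h \<in> SP" "ell h = 1 + real (s + Suc j)"
  shows "cmod (f g - f h) \<le> C * (2 powr (p - 1) * (real CARD('k))\<^sup>2) powr (1 / p)
    * (real CARD('k) powr (- (p - 4) / (2 * p))) ^ (s - j)"
proof -
  interpret D: dual_family Sp4 "Vset s" "usp s" "Vset s" "\<lambda>x v. \<psi> (phase s x v)" by (rule dual_family_Sp4)
  define Q where "Q = real CARD('k)"
  have Q: "1 < Q" using card_gt_1 by (simp add: Q_def)
  let ?B = "2 * Q ^ j * sqrt (Q ^ (s + 2 + j))"
  let ?E = "2 * Q ^ (s + 1 + j)"
  let ?L = "(real (card (Vset s)) * ?B powr (p - 2) * ?E) powr (1 / p)"
  have "cmod (\<Sum>v\<in>Vset s. f (usp s v) * test s j v) \<le> C * ?L"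
  proof (rule D.MLp_estimate[OF bdd])
    show "0 \<in> Vset s" by (rule D.zeroV)
    show "\<psi> (phase s 0 v) = 1" for v by (simp add: phase_def pairing_def psi_zero)
  qed (use ft_test_bound[OF \<open>j < s\<close>] sum_test_square[OF \<open>j < s\<close>] Q \<open>4 < p\<close> in \<open>auto simp: Q_def\<close>)
  then have "Q ^ (s + 1 + j) * cmod (f g - f h) \<le> C * ?L"
    unfolding sum_radial_test[OF \<open>j < s\<close> f g h] by (simp add: norm_mult norm_power Q_def)
  also have "?L = Q ^ (s + 1 + j) * ((2 powr (p - 1) * Q\<^sup>2) powr (1 / p) * (Q powr (- (p - 4) / (2 * p))) ^ (s - j))"
  proof -
    \<comment> \<open>In terms of a and r, a level set has q^a points, the transform bound is 2 q^(a
      - r/2) and the group order is q^(a + r + 2). In the product below, r gets the coefficient 1 -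
      (p - 2)/2 = -(p - 4)/2.\<close>
    define a where "a = real s + 1 + real j"
    define r where "r = real (s - j)"
    have B: "?B = 2 * Q powr (a - r / 2)"
    proof -
      have "Q ^ j * sqrt (Q ^ (s + 2 + j)) = Q powr (real j + real (s + 2 + j) / 2)"
        using Q by (intro power_times_sqrt_power) simp
      also have "real j + real (s + 2 + j) / 2 = a - r / 2"
        using \<open>j < s\<close> by (simp add: a_def r_def of_nat_diff field_simps)
      finally show ?thesis by simp
    qed
    have N: "real (card (Vset s)) = Q powr (a + r + 2)"
    proof -
      have "real (card (Vset s)) = Q powr real (2 * s + 3)"
        using Q by (subst powr_realpow) (auto simp: card_Vset Q_def)
      also have "real (2 * s + 3) = a + r + 2" using \<open>j < s\<close> by (simp add: a_def r_def of_nat_diff)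
      finally show ?thesis .
    qed
    have E: "Q ^ (s + 1 + j) = Q powr a" using Q powr_realpow[of Q "s + 1 + j"] by (simp add: a_def add_ac)
    have two: "(2::real) * 2 powr (p - 2) = 2 powr (p - 1)"
      using powr_add[of 2 1 "p - 2"] by simp
    have "real (card (Vset s)) * ?B powr (p - 2) * ?E
        = (2 * 2 powr (p - 2)) * (Q powr (a + r + 2) * Q powr ((a - r / 2) * (p - 2)) * Q powr a)"
      unfolding B N E by (simp add: powr_mult powr_powr mult_ac)
    also have "\<dots> = 2 powr (p - 1) * Q powr (a * p + 2 + (- (p - 4) / 2 * r))"
      unfolding two powr_add[symmetric] by (simp add: field_simps)
    also have "\<dots> = (2 powr (p - 1) * Q powr 2) * (Q powr (a * p) * Q powr (- (p - 4) / 2 * r))"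
      by (simp only: powr_add mult_ac)
    also have "Q powr 2 = Q\<^sup>2" using Q by (subst powr_numeral) auto
    finally have "?L = (2 powr (p - 1) * Q\<^sup>2) powr (1 / p) * (Q powr a * Q powr (- (p - 4) / (2 * p) * r))"
      using \<open>4 < p\<close> Q by (simp add: powr_mult powr_powr field_simps)
    moreover have "Q powr (- (p - 4) / (2 * p) * r) = (Q powr (- (p - 4) / (2 * p))) ^ (s - j)"
      unfolding r_def using Q powr_affine[of Q 0 "- (p - 4) / (2 * p)" "s - j"] by simp
    ultimately show ?thesis unfolding E by (simp only: mult_ac)
  qed
  also have "C * (Q ^ (s + 1 + j) * ((2 powr (p - 1) * Q\<^sup>2) powr (1 / p) * (Q powr (- (p - 4) / (2 * p))) ^ (s - j)))
      = Q ^ (s + 1 + j) * (C * (2 powr (p - 1) * Q\<^sup>2) powr (1 / p) * (Q powr (- (p - 4) / (2 * p))) ^ (s - j))"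
    by (simp only: mult_ac)
  finally show ?thesis using Q by (simp add: Q_def)
qed

text \<open>Level \<open>v\<close> is realised with \<open>s = v - v div 3\<close> and \<open>j = v div 3\<close>, so that \<open>s - j\<close> is at least \<open>v / 3\<close>.\<close>
lemma no_radial_approx:
  fixes K \<rho> :: real
  assumes K: "0 \<le> K" and \<rho>: "0 < \<rho>" "\<rho> < 1"
    and decay: "\<And>f C s j g h. bdd C f \<Longrightarrow> radial Sp4 ell f \<Longrightarrow> j < s \<Longrightarrow> g \<in> SP \<Longrightarrow> ell g = 1 + real (s + j)
      \<Longrightarrow> h \<in> SP \<Longrightarrow> ell h = 1 + real (s + Suc j) \<Longrightarrow> cmod (f g - f h) \<le> C * K * \<rho> ^ (s - j)"
  shows "\<not> one_radial_approx (Sp4 :: ('k poly^4^4) monoid) ell bdd"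
proof
  assume "one_radial_approx (Sp4 :: ('k poly^4^4) monoid) ell bdd"
  then obtain I :: "('k poly^4^4 \<Rightarrow> complex) set" and F fam C where F: "F \<noteq> bot" "eventually (\<lambda>\<alpha>. \<alpha> \<in> I) F"
    and fam: "\<And>\<alpha>. \<alpha> \<in> I \<Longrightarrow> fin_supp Sp4 (fam \<alpha>) \<and> radial Sp4 ell (fam \<alpha>) \<and> bdd C (fam \<alpha>)"
    and lim: "\<And>g. g \<in> SP \<Longrightarrow> ((\<lambda>\<alpha>. fam \<alpha> g) \<longlongrightarrow> 1) F"
    unfolding one_radial_approx_def by blast
  define G where "G = (\<lambda>v. usp (v - v div 3) (point (v - v div 3) (v div 3) (0, 0)))"
  have GS: "G v \<in> SP" for v by (simp add: G_def usp_def umat_Sp4)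
  have Gell: "ell (G v) = 1 + real v" for v
  proof -
    have "(0, 0) \<in> Yset (v - v div 3) (v div 3)" by (simp add: Yset_def polys_below_closed)
    then have "ell (G v) = 1 + real (v - v div 3 + v div 3)" unfolding G_def by (rule ell_usp_point) auto
    then show ?thesis by simp
  qed
  then have injG: "inj G" by (metis injI add_left_cancel of_nat_eq_iff)
  \<comment> \<open>The cube root matches the lower bound v / 3 for s - j: the decay is geometric in
    the level itself.\<close>
  define \<sigma> where "\<sigma> = \<rho> powr (1 / 3)"
  have \<sigma>: "0 < \<sigma>" "\<sigma> < 1" using \<rho> powr_less_mono2[of "1/3" \<rho> 1] by (auto simp: \<sigma>_def)
  \<comment> \<open>The sign of the bound \<open>C\<close> is not known in advance, hence the
    absolute value.\<close>
  define D where "D = \<bar>C\<bar> * K"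
  have D: "0 \<le> D" using K by (simp add: D_def)
  have small: "cmod (fam \<alpha> (G v)) \<le> D * \<sigma> ^ v / (1 - \<sigma>)" if \<alpha>: "\<alpha> \<in> I" and "1 \<le> v" for \<alpha> v
  proof -
    let ?f = "fam \<alpha>"
    have step: "cmod (?f (G v) - ?f (G (Suc v))) \<le> D * \<sigma> ^ v" if "1 \<le> v" for v
    proof -
      let ?j = "v div 3" and ?s = "v - v div 3"
      have js: "?j < ?s" "real v / 3 \<le> real (?s - ?j)" using that by linarith+
      have "cmod (?f (G v) - ?f (G (Suc v))) \<le> C * K * \<rho> ^ (?s - ?j)"
        \<comment> \<open>\<open>G (Suc v)\<close> is built with its own s and j, but only its
          length, 1 + s + (j + 1) in terms of those for v, enters \<open>decay\<close>.\<close>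
        by (rule decay) (use fam[OF \<alpha>] js GS Gell in auto)
      also have "\<dots> \<le> D * \<rho> ^ (?s - ?j)"
        unfolding D_def using \<rho> K by (intro mult_right_mono) auto
      also have "\<rho> ^ (?s - ?j) = \<rho> powr real (?s - ?j)" by (rule powr_realpow[OF \<rho>(1), symmetric])
      also have "\<dots> \<le> \<rho> powr (real v / 3)" using js \<rho> by (intro powr_mono') auto
      also have "\<dots> = \<sigma> ^ v" using \<rho> by (simp add: \<sigma>_def powr_powr flip: powr_realpow)
      finally show ?thesis using D by (simp add: mult_left_mono)
    qed
    have "finite {v. ?f (G v) \<noteq> 0}"
    proof -
      have "finite (G -` {g \<in> SP. ?f g \<noteq> 0})"
        using fam[OF \<alpha>] injG unfolding fin_supp_def by (intro finite_vimageI) auto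
      then show ?thesis by (rule rev_finite_subset) (auto simp: GS)
    qed
    then obtain M where M: "\<And>v. M \<le> v \<Longrightarrow> ?f (G v) = 0"
      unfolding finite_nat_set_iff_bounded by (metis mem_Collect_eq not_less)
    \<comment> \<open>Descent from a level M beyond the support: the increments sum to a geometric
      tail, and the resulting bound no longer depends on M or on \<alpha>.\<close>
    have "cmod (?f (G v)) \<le> D * \<sigma> ^ v / (1 - \<sigma>)" if "1 \<le> v" "M \<le> v + n" for v n
      using that
    proof (induction n arbitrary: v)
      case 0
      then show ?case using M[of v] D \<sigma> by simp
    next
      case (Suc n)
      have "cmod (?f (G v)) \<le> cmod (?f (G v) - ?f (G (Suc v))) + cmod (?f (G (Suc v)))"
        by (metis diff_add_cancel norm_triangle_ineq)
      also have "\<dots> \<le> D * \<sigma> ^ v + D * \<sigma> ^ Suc v / (1 - \<sigma>)"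
        using Suc by (intro add_mono step Suc.IH) auto
      also have "\<dots> = D * \<sigma> ^ v / (1 - \<sigma>)" using \<sigma> by (simp add: field_simps)
      finally show ?case .
    qed
    from this[OF \<open>1 \<le> v\<close>, of M] show ?thesis by simp
  qed
  obtain n where n: "\<sigma> ^ n < (1 - \<sigma>) / (2 * (D + 1))"
    using real_arch_pow_inv[of "(1 - \<sigma>) / (2 * (D + 1))" \<sigma>] \<sigma> D by auto
  have "\<sigma> ^ Suc n \<le> \<sigma> ^ n" using \<sigma> by (intro power_decreasing) auto
  with n have "\<sigma> ^ Suc n \<le> (1 - \<sigma>) / (2 * (D + 1))" by linarith
  then have "D * \<sigma> ^ Suc n / (1 - \<sigma>) \<le> D * ((1 - \<sigma>) / (2 * (D + 1))) / (1 - \<sigma>)"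
    using \<sigma> D by (intro divide_right_mono mult_left_mono) auto
  also have "\<dots> = D / (2 * (D + 1))" using \<sigma> by simp
  also have "\<dots> \<le> 1 / 2" using D by (simp add: field_simps)
  finally have half: "D * \<sigma> ^ Suc n / (1 - \<sigma>) \<le> 1 / 2" .
  have "eventually (\<lambda>\<alpha>. dist (fam \<alpha> (G (Suc n))) 1 < 1 / 2) F"
    by (rule tendstoD[OF lim[OF GS]]) simp
  with F(2) have "eventually (\<lambda>\<alpha>. False) F"
  proof eventually_elim
    case (elim \<alpha>)
    have "cmod (fam \<alpha> (G (Suc n))) \<le> 1 / 2" by (rule order_trans[OF small[OF elim(1)] half]) simp
    moreover have "cmod 1 \<le> cmod (fam \<alpha> (G (Suc n))) + cmod (fam \<alpha> (G (Suc n)) - 1)"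
      by (metis add_diff_cancel_left' diff_add_cancel norm_minus_commute norm_triangle_sub)
    ultimately show False using elim(2) by (simp add: dist_norm)
  qed
  then show False using F(1) by (simp add: eventually_False)
qed

lemma not_approx_MCr: "\<not> one_radial_approx (Sp4 :: ('k poly^4^4) monoid) ell (MCr_bounded_by Sp4)"
proof (rule no_radial_approx[where K = 2 and \<rho> = "real CARD('k) powr (- 1 / 2)"])
  show "real CARD('k) powr (- 1 / 2) < 1" using card_gt_1 powr_less_mono[of "- 1 / 2" 0 "real CARD('k)"] by simp
  show "0 < real CARD('k) powr (- 1 / 2)" using card_gt_1 by simp
qed (simp, rule MCr_level_decay)

lemma not_approx_MLp:
  assumes "4 < p"
  shows "\<not> one_radial_approx (Sp4 :: ('k poly^4^4) monoid) ell (MLp_bounded_by Sp4 p)"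
proof (rule no_radial_approx[where K = "(2 powr (p - 1) * (real CARD('k))\<^sup>2) powr (1 / p)"
      and \<rho> = "real CARD('k) powr (- (p - 4) / (2 * p))"])
  have "- (p - 4) / (2 * p) < 0" using assms by (simp add: field_simps)
  then show "real CARD('k) powr (- (p - 4) / (2 * p)) < 1"
    using card_gt_1 powr_less_mono[of "- (p - 4) / (2 * p)" 0 "real CARD('k)"] by simp
  show "0 < real CARD('k) powr (- (p - 4) / (2 * p))" using card_gt_1 by simp
qed (simp, rule MLp_level_decay[OF assms])

end

theorem theorem1p4:
  assumes "odd CARD('k::{field,finite})"
  shows "\<exists>l. length_function (Sp4 :: ('k poly ^ 4 ^ 4) monoid) l \<and>
             bilipschitz_to_word_length Sp4 l \<and>
             \<not> one_radial_approx Sp4 l (MCr_bounded_by Sp4) \<and>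
             (\<forall>p::real. p > 4 \<longrightarrow> \<not> one_radial_approx Sp4 l (MLp_bounded_by Sp4 p))"
proof -
  have two: "(2::'k) \<noteq> 0" by (rule two_neq_zero_of_odd_card[OF assms])
  obtain \<psi> :: "'k \<Rightarrow> complex" where "\<forall>x y. \<psi> (x + y) = \<psi> x * \<psi> y" "\<forall>x. cmod (\<psi> x) = 1" "\<exists>t. \<psi> t \<noteq> 1"
    using exists_additive_character[where 'k = 'k] by blast
  then interpret additive_character \<psi> using two by unfold_locales auto
  show ?thesis
    using length_function_ell[OF two] bilipschitz_ell[OF two] not_approx_MCr not_approx_MLp by blast
qed

end
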